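(* Let $\Omega$ be a bounded domain in $\mathbb{R}^2$ and $2<p<\infty$. Suppose $A:\mathbb{R}^2\to\mathbb{R}^{2\times2}$ is measurable and satisfies the ellipticity condition (E) with constant $\delta\in(0,1)$, $\operatorname{div}A\in L^2(\Omega;\mathbb{R}^2)$, $\mathbf{b}\in L^2(\Omega;\mathbb{R}^2)$, and $\lambda\ge0$. Then there is a constant $\gamma>0$ depending only on $p$, $\delta$, $\|\operatorname{div}A\|_{L^2(\Omega)}$ and $\|\mathbf{b}\|_{L^2(\Omega)}$ such that, if $A$ satisfies Assumption $\mathrm{A}(\gamma)$ and $u\in W^{1,p}_0(\Omega)$ satisfies $$\int_\Omega A\nabla u\cdot\nabla\phi+(\mathbf{b}\cdot\nabla u+\lambda u)\phi\,dx=0\quad\text{for all }\phi\in C_c^\infty(\Omega),$$ then $u\equiv0$ in $\Omega$.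
   Context: Ellipticity condition (E): $\delta|\xi|^2\le\sum_{i,j=1}^2 a^{ij}(x)\xi_i\xi_j$ and $\max_{i,j}|a^{ij}(x)|\le\delta^{-1}$ for all $x,\xi\in\mathbb{R}^2$. Weak $L^2$-divergence: $\operatorname{div}A\in L^2(\Omega;\mathbb{R}^2)$ means there is $\mathbf{c}\in L^2(\Omega;\mathbb{R}^2)$ with $\int_\Omega\sum_{i,j=1}^2 a^{ij}D_i\phi^j\,dx=-\int_\Omega\mathbf{c}\cdot\Phi\,dx$ for all $\Phi=(\phi^1,\phi^2)\in C_c^\infty(\Omega;\mathbb{R}^2)$; then $\operatorname{div}A:=\mathbf{c}$. Assumption $\mathrm{A}(\gamma)$: there is $R_0\in(0,1]$ such that $\max_{i,j}\frac{1}{|B_r(x)|}\int_{B_r(x)}|a^{ij}(y)-(a^{ij})_{B_r(x)}|\,dy\le\gamma$ for all $x\in\mathbb{R}^2$ and $0<r\le R_0$, where $(a^{ij})_{B_r(x)}$ is the average of $a^{ij}$ over $B_r(x)$. $W^{1,p}_0(\Omega)$ is the closure of $C_c^\infty(\Omega)$ in $W^{1,p}(\Omega)$. *)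

theory Defs
  imports "HOL-Analysis.Analysis"
begin

type_synonym pt = "real^2"

definition pd :: "2 \<Rightarrow> (pt \<Rightarrow> real) \<Rightarrow> pt \<Rightarrow> real" where
  "pd i f x = frechet_derivative f (at x) (axis i 1)"

definition cgrad :: "(pt \<Rightarrow> real) \<Rightarrow> pt \<Rightarrow> pt" where
  "cgrad f x = (\<chi> i. pd i f x)"

definition smooth :: "(pt \<Rightarrow> real) \<Rightarrow> bool" where
  "smooth f \<longleftrightarrow> (\<forall>is :: 2 list. \<forall>x. (fold pd is f) differentiable (at x))"

text \<open>C_c^infinity(Omega) (extended by zero to the plane).\<close>
definition test_fun :: "pt set \<Rightarrow> (pt \<Rightarrow> real) \<Rightarrow> bool" where
  "test_fun \<Omega> \<phi> \<longleftrightarrow> smooth \<phi> \<and> compact (closure {x. \<phi> x \<noteq> 0})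
       \<and> closure {x. \<phi> x \<noteq> 0} \<subseteq> \<Omega>"

definition Lp :: "real \<Rightarrow> pt set \<Rightarrow> (pt \<Rightarrow> 'b::euclidean_space) \<Rightarrow> bool" where
  "Lp p \<Omega> f \<longleftrightarrow> f \<in> borel_measurable (lebesgue_on \<Omega>)
      \<and> integrable (lebesgue_on \<Omega>) (\<lambda>x. norm (f x) powr p)"

definition Lp_norm :: "real \<Rightarrow> pt set \<Rightarrow> (pt \<Rightarrow> 'b::euclidean_space) \<Rightarrow> real" where
  "Lp_norm p \<Omega> f = (integral\<^sup>L (lebesgue_on \<Omega>) (\<lambda>x. norm (f x) powr p)) powr (1/p)"

definition weak_grad :: "pt set \<Rightarrow> (pt \<Rightarrow> real) \<Rightarrow> (pt \<Rightarrow> pt) \<Rightarrow> bool" where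
  "weak_grad \<Omega> u g \<longleftrightarrow> (\<forall>\<phi>. test_fun \<Omega> \<phi> \<longrightarrow> (\<forall>i.
      integral\<^sup>L (lebesgue_on \<Omega>) (\<lambda>x. u x * pd i \<phi> x)
        = - integral\<^sup>L (lebesgue_on \<Omega>) (\<lambda>x. g x $ i * \<phi> x)))"

definition W01p :: "real \<Rightarrow> pt set \<Rightarrow> (pt \<Rightarrow> real) \<Rightarrow> (pt \<Rightarrow> pt) \<Rightarrow> bool" where
  "W01p p \<Omega> u g \<longleftrightarrow> Lp p \<Omega> u \<and> Lp p \<Omega> g \<and> weak_grad \<Omega> u g \<and>
     (\<exists>\<phi> :: nat \<Rightarrow> pt \<Rightarrow> real. (\<forall>n. test_fun \<Omega> (\<phi> n)) \<and>
        (\<lambda>n. Lp_norm p \<Omega> (\<lambda>x. \<phi> n x - u x)) \<longlonglongrightarrow> 0 \<and>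
        (\<lambda>n. Lp_norm p \<Omega> (\<lambda>x. cgrad (\<phi> n) x - g x)) \<longlonglongrightarrow> 0)"

definition elliptic :: "real \<Rightarrow> (pt \<Rightarrow> real^2^2) \<Rightarrow> bool" where
  "elliptic \<delta> A \<longleftrightarrow>
     (\<forall>x \<xi>. \<delta> * (norm \<xi>)\<^sup>2 \<le> (\<Sum>i\<in>UNIV. \<Sum>j\<in>UNIV. A x $ i $ j * \<xi> $ i * \<xi> $ j))
   \<and> (\<forall>x i j. \<bar>A x $ i $ j\<bar> \<le> 1 / \<delta>)"

definition weak_div :: "pt set \<Rightarrow> (pt \<Rightarrow> real^2^2) \<Rightarrow> (pt \<Rightarrow> pt) \<Rightarrow> bool" where
  "weak_div \<Omega> A c \<longleftrightarrow> Lp 2 \<Omega> c \<and>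
     (\<forall>\<Phi> :: 2 \<Rightarrow> pt \<Rightarrow> real. (\<forall>j. test_fun \<Omega> (\<Phi> j)) \<longrightarrow>
        integral\<^sup>L (lebesgue_on \<Omega>) (\<lambda>x. \<Sum>i\<in>UNIV. \<Sum>j\<in>UNIV. A x $ i $ j * pd i (\<Phi> j) x)
        = - integral\<^sup>L (lebesgue_on \<Omega>) (\<lambda>x. \<Sum>j\<in>UNIV. c x $ j * \<Phi> j x))"

definition ball_avg :: "(pt \<Rightarrow> real) \<Rightarrow> pt \<Rightarrow> real \<Rightarrow> real" where
  "ball_avg f x r = integral\<^sup>L (lebesgue_on (ball x r)) f / measure lebesgue (ball x r)"

definition assumption_A :: "real \<Rightarrow> (pt \<Rightarrow> real^2^2) \<Rightarrow> bool" where
  "assumption_A \<gamma> A \<longleftrightarrow> (\<exists>R0. 0 < R0 \<and> R0 \<le> 1 \<and>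
     (\<forall>x r. 0 < r \<and> r \<le> R0 \<longrightarrow> (\<forall>i j.
        integral\<^sup>L (lebesgue_on (ball x r))
          (\<lambda>y. \<bar>A y $ i $ j - ball_avg (\<lambda>z. A z $ i $ j) x r\<bar>) / measure lebesgue (ball x r)
        \<le> \<gamma>)))"

end

theory Submission
  imports Defs
begin

text \<open>
  Let \<open>v\<close> be a smooth approximant of \<open>u\<close>, with the sign chosen so that
  \<open>M = max \<bar>v\<bar> = v x\<close> at some point \<open>x\<close>. Testing the equation with \<open>1 / (M + e - v) - 1 / (M + e)\<close>,
  which vanishes where \<open>v\<close> does and is dominated by \<open>1 / (M + e - v)\<close>, bounds the Dirichlet
  energy of \<open>w = - ln (M + e - v)\<close> by a constant independent of \<open>e\<close>, because the drift term
  is absorbed using only the \<open>L\<^sup>2\<close> norm of \<open>b\<close>. On the other hand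
  \<open>u \<in> W\<^sup>1\<^sup>,\<^sup>p\<close> with \<open>p > 2\<close> forces \<open>M - v \<le> C r\<^sup>\<alpha>\<close> on average at distance \<open>r\<close> from \<open>x\<close>, so \<open>w\<close>
  grows by about \<open>ln (1 / e)\<close> between the boundary and the scale \<open>r = e\<^bsup>1/\<alpha>\<^esup>\<close>. In the plane this
  costs energy of order \<open>ln (1 / e)\<close>, a contradiction as \<open>e \<rightarrow> 0\<close> unless \<open>M\<close> is \<open>0\<close> in the limit.
  Both radial estimates are averaged over the cone \<open>x + s (1, t)\<close> with \<open>0 \<le> t \<le> 1\<close>, where the area
  element is \<open>s ds dt\<close>.
\<close>

subsection \<open>Smooth functions\<close>

lemma smooth_iff: "smooth f \<longleftrightarrow> (\<forall>x. f differentiable (at x)) \<and> (\<forall>i. smooth (pd i f))"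
proof safe
  fix x assume "smooth f" 
  then have "(fold pd [] f) differentiable (at x)" unfolding smooth_def by blast
  then show "f differentiable (at x)" by simp
next
  fix i assume a: "smooth f"
  show "smooth (pd i f)" unfolding smooth_def
  proof safe
    fix js :: "2 list" and x
    have "(fold pd (i # js) f) differentiable (at x)" using a unfolding smooth_def by blast
    then show "(fold pd js (pd i f)) differentiable (at x)" by simp
  qed
next
  assume a: "\<forall>x. f differentiable (at x)" "\<forall>i. smooth (pd i f)"
  show "smooth f" unfolding smooth_def
  proof safe
    fix js :: "2 list" and x
    show "(fold pd js f) differentiable (at x)"
      using a by (cases js) (auto simp: smooth_def)
  qed
qed

text \<open>Any class of differentiable functions that is closed under \<open>pd\<close> consists of
  smooth functions, since iterated derivatives never leave it. This avoids formulas for derivatives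
  of higher order.\<close>

lemma smooth_coinduct:
  assumes "P f" and step: "\<And>f. P f \<Longrightarrow> (\<forall>x. f differentiable (at x)) \<and> (\<forall>i. P (pd i f))"
  shows "smooth f"
proof -
  have "P f \<Longrightarrow> P (fold pd js f)" for js f
    by (induction js arbitrary: f) (use step in auto)
  then show ?thesis using assms unfolding smooth_def by blast
qed

lemma smooth_differentiable: "smooth f \<Longrightarrow> f differentiable (at x)"
  using smooth_iff by blast

lemma smooth_pd: "smooth f \<Longrightarrow> smooth (pd i f)"
  using smooth_iff by blast

lemma pd_eqI: "(f has_derivative f') (at x) \<Longrightarrow> pd i f x = f' (axis i 1)"
  by (metis pd_def frechet_derivative_at)

lemma pd_add:
  assumes "f differentiable (at x)" "g differentiable (at x)"
  shows "pd i (\<lambda>x. f x + g x) x = pd i f x + pd i g x"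
proof -
  have "((\<lambda>x. f x + g x) has_derivative (\<lambda>h. frechet_derivative f (at x) h + frechet_derivative g (at x) h)) (at x)"
    using assms by (auto intro!: has_derivative_add simp: frechet_derivative_works[symmetric])
  from pd_eqI[OF this] show ?thesis by (simp add: pd_def)
qed

lemma pd_mult:
  assumes "f differentiable (at x)" "g differentiable (at x)"
  shows "pd i (\<lambda>x. f x * g x) x = f x * pd i g x + pd i f x * g x"
proof -
  have "((\<lambda>x. f x * g x) has_derivative (\<lambda>h. f x * frechet_derivative g (at x) h + frechet_derivative f (at x) h * g x)) (at x)"
    using assms by (intro has_derivative_mult) (auto simp: frechet_derivative_works[symmetric])
  from pd_eqI[OF this] show ?thesis by (simp add: pd_def)
qed

lemma pd_inverse:
  assumes "f differentiable (at x)" "f x \<noteq> 0"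
  shows "pd i (\<lambda>x. inverse (f x)) x = - (inverse (f x) * pd i f x * inverse (f x))"
proof -
  have "((\<lambda>x. inverse (f x)) has_derivative (\<lambda>h. - (inverse (f x) * frechet_derivative f (at x) h * inverse (f x)))) (at x)"
    using assms by (intro Deriv.has_derivative_inverse) (auto simp: frechet_derivative_works[symmetric])
  from pd_eqI[OF this] show ?thesis by (simp add: pd_def)
qed

lemma smooth_const: "smooth (\<lambda>x. c)"
proof -
  have "pd i (\<lambda>x. c) = (\<lambda>x. 0)" for i and c :: real by (auto simp: pd_def)
  then show ?thesis by (intro smooth_coinduct[where P = "\<lambda>f. \<exists>c. f = (\<lambda>x. c)"]) auto
qed

text \<open>Unlike the class of reciprocals, this algebra is closed under partial differentiation.\<close>

inductive inverse_algebra :: "(pt \<Rightarrow> real) \<Rightarrow> (pt \<Rightarrow> real) \<Rightarrow> bool" for y where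
  smooth: "smooth f \<Longrightarrow> inverse_algebra y f"
| inverse: "inverse_algebra y (\<lambda>x. inverse (y x))"
| add: "inverse_algebra y f \<Longrightarrow> inverse_algebra y g \<Longrightarrow> inverse_algebra y (\<lambda>x. f x + g x)"
| mult: "inverse_algebra y f \<Longrightarrow> inverse_algebra y g \<Longrightarrow> inverse_algebra y (\<lambda>x. f x * g x)"

text \<open>Coinduction with the algebra itself as the invariant class. The only generator to watch
  is the reciprocal, whose derivative is a product of two reciprocals and a smooth function and so
  stays in the algebra.\<close>

lemma inverse_algebra_smooth:
  assumes y: "smooth y" "\<And>x. y x \<noteq> 0" and "inverse_algebra y f"
  shows "smooth f"
proof (rule smooth_coinduct[of "inverse_algebra y"])
  fix f assume "inverse_algebra y f"
  then show "(\<forall>x. f differentiable (at x)) \<and> (\<forall>i. inverse_algebra y (pd i f))"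
  proof induction
    case (smooth f)
    then show ?case using smooth_iff inverse_algebra.smooth by blast
  next
    case inverse
    have "pd i (\<lambda>x. inverse (y x))
      = (\<lambda>x. (- 1) * (inverse (y x) * pd i y x * inverse (y x)))" for i
      using y by (auto simp: pd_inverse smooth_differentiable)
    moreover have "inverse_algebra y (\<lambda>x. (- 1) * (inverse (y x) * pd i y x * inverse (y x)))" for i
      by (intro inverse_algebra.mult inverse_algebra.inverse)
        (auto intro!: inverse_algebra.smooth smooth_const smooth_pd y)
    moreover have "(\<lambda>x. inverse (y x)) differentiable (at x)" for x
      using y by (intro differentiable_inverse smooth_differentiable)
    ultimately show ?case by simp
  next
    case (add f g)
    then have "pd i (\<lambda>x. f x + g x) = (\<lambda>x. pd i f x + pd i g x)" for i
      by (auto simp: pd_add)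
    with add show ?case by (auto intro: inverse_algebra.intros)
  next
    case (mult f g)
    then have "pd i (\<lambda>x. f x * g x) = (\<lambda>x. f x * pd i g x + pd i f x * g x)" for i
      by (auto simp: pd_mult)
    with mult show ?case by (auto intro!: inverse_algebra.add inverse_algebra.mult)
  qed
qed (fact assms)

text \<open>The special case \<open>y = 1\<close> of the algebra, in which the reciprocal generator
  is a constant. Products are treated in the same way.\<close>

lemma smooth_add:
  assumes "smooth f" "smooth g" shows "smooth (\<lambda>x. f x + g x)"
  by (rule inverse_algebra_smooth[of "\<lambda>x. 1", OF smooth_const _ inverse_algebra.add[OF assms[THEN inverse_algebra.smooth]]])
    simp

lemma smooth_mult:
  assumes "smooth f" "smooth g" shows "smooth (\<lambda>x. f x * g x)"
  by (rule inverse_algebra_smooth[of "\<lambda>x. 1", OF smooth_const _ inverse_algebra.mult[OF assms[THEN inverse_algebra.smooth]]])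
    simp

lemma smooth_inverse: "smooth f \<Longrightarrow> (\<And>x. f x \<noteq> 0) \<Longrightarrow> smooth (\<lambda>x. inverse (f x))"
  by (rule inverse_algebra_smooth[OF _ _ inverse_algebra.inverse])

text \<open>A linear map on the plane is determined by its values on the axis vectors, and these are
  the partial derivatives collected in \<open>cgrad\<close>.\<close>

lemma smooth_has_derivative:
  assumes "smooth f" shows "(f has_derivative (\<lambda>h. cgrad f x \<bullet> h)) (at x)"
proof -
  let ?D = "frechet_derivative f (at x)"
  have D: "(f has_derivative ?D) (at x)"
    using smooth_differentiable[OF assms] frechet_derivative_works by blast
  then interpret linear ?D by (rule has_derivative_linear)
  have "?D h = cgrad f x \<bullet> h" for h
  proof -
    have "?D h = ?D (\<Sum>i\<in>UNIV. h $ i *\<^sub>R axis i 1)"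
      by (metis basis_expansion scalar_mult_eq_scaleR)
    also have "\<dots> = cgrad f x \<bullet> h"
      by (simp add: sum scale cgrad_def inner_vec_def pd_def mult.commute)
    finally show ?thesis .
  qed
  then have "?D = (\<lambda>h. cgrad f x \<bullet> h)" by blast
  with D show ?thesis by simp
qed

lemma cgrad_eqI:
  assumes "(f has_derivative (\<lambda>h. d \<bullet> h)) (at x)" shows "cgrad f x = d"
  by (simp add: vec_eq_iff cgrad_def pd_eqI[OF assms] inner_axis)

lemma smooth_continuous: "smooth f \<Longrightarrow> continuous_on S f"
  by (meson continuous_at_imp_continuous_on differentiable_imp_continuous_within smooth_differentiable)

lemma smooth_continuous_cgrad: "smooth f \<Longrightarrow> continuous_on S (cgrad f)"
  unfolding cgrad_def by (intro continuous_on_vec_lambda smooth_continuous smooth_pd)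

subsection \<open>Integration over cones\<close>

lemma borel_measurable_vec2 [measurable]:
  assumes [measurable]: "f \<in> borel_measurable M" "g \<in> borel_measurable M"
  shows "(\<lambda>x. vector [f x, g x] :: pt) \<in> borel_measurable M"
proof -
  have "(\<lambda>x. f x *\<^sub>R axis 1 1 + g x *\<^sub>R axis 2 1 :: pt) \<in> borel_measurable M"
    by measurable
  also have "(\<lambda>x. f x *\<^sub>R axis 1 1 + g x *\<^sub>R axis 2 1 :: pt) = (\<lambda>x. vector [f x, g x])"
    by (auto simp: vec_eq_iff forall_2 fun_eq_iff axis_def)
  finally show ?thesis .
qed

lemma borel_measurable_vec2_pair [measurable]:
  "(\<lambda>z. vector [fst z, snd z] :: pt) \<in> borel_measurable borel"
  by (intro borel_measurable_vec2 borel_measurable_continuous_onI continuous_intros)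

text \<open>Lebesgue measure is determined by its values on boxes, and the image measure also gives
  a box the product of its side lengths. The identification carries Fubini's theorem from
  \<open>real \<times> real\<close> over to \<open>real^2\<close>.\<close>

lemma lborel_vec2: "lborel = distr (lborel :: (real \<times> real) measure) borel (\<lambda>(a, b). vector [a, b] :: pt)"
proof (rule lborel_eqI)
  have [measurable]: "(\<lambda>(a, b). vector [a, b] :: pt) \<in> borel_measurable borel"
    unfolding split_beta by (fact borel_measurable_vec2_pair)
  fix l u :: pt assume lu: "\<And>b. b \<in> Basis \<Longrightarrow> l \<bullet> b \<le> u \<bullet> b"
  have Basis: "(Basis :: pt set) = {axis 1 1, axis 2 1}"
    by (auto simp: Basis_vec_def UNIV_2)
  have ne: "axis 1 1 \<noteq> (axis 2 1 :: pt)" by (simp add: axis_eq_axis)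
  have le: "l $ 1 \<le> u $ 1" "l $ 2 \<le> u $ 2"
    using lu[of "axis 1 1"] lu[of "axis 2 1"] by (auto simp: Basis inner_axis)
  have "(\<lambda>(a, b). vector [a, b] :: pt) -` box l u = box (l $ 1, l $ 2) (u $ 1, u $ 2)"
    by (auto simp: mem_box_cart forall_2 box_prod mem_box)
  then have "emeasure (distr lborel borel (\<lambda>(a, b). vector [a, b] :: pt)) (box l u)
      = emeasure lborel (box (l $ 1, l $ 2) (u $ 1, u $ 2))"
    by (subst emeasure_distr) auto
  also have "\<dots> = ennreal ((u $ 1 - l $ 1) * (u $ 2 - l $ 2))"
    using le by (subst emeasure_lborel_box) (auto simp: Basis_prod_def prod.union_disjoint)
  also have "\<dots> = (\<Prod>b\<in>Basis. (u - l) \<bullet> b)"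
    using ne by (simp add: Basis inner_axis)
  finally show "emeasure (distr lborel borel (\<lambda>(a, b). vector [a, b] :: pt)) (box l u) = (\<Prod>b\<in>Basis. (u - l) \<bullet> b)" .
qed simp

lemma nn_integral_lborel_vec2:
  fixes h :: "pt \<Rightarrow> ennreal"
  assumes [measurable]: "h \<in> borel_measurable borel"
  shows "(\<integral>\<^sup>+ x. h x \<partial>lborel) = (\<integral>\<^sup>+ a. \<integral>\<^sup>+ b. h (vector [a, b]) \<partial>lborel \<partial>lborel)"
proof -
  have "(\<integral>\<^sup>+ x. h x \<partial>lborel) = (\<integral>\<^sup>+ z. h (vector [fst z, snd z]) \<partial>(lborel \<Otimes>\<^sub>M lborel))"
    by (subst lborel_vec2, subst nn_integral_distr) (auto simp: lborel_prod split_beta)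
  also have "\<dots> = (\<integral>\<^sup>+ a. \<integral>\<^sup>+ b. h (vector [a, b]) \<partial>lborel \<partial>lborel)"
    by (subst lborel.nn_integral_fst[symmetric]) auto
  finally show ?thesis .
qed

text \<open>The map \<open>(s, t) \<mapsto> x + s (1, t)\<close> has Jacobian \<open>s\<close> and
  is injective for \<open>s > 0\<close>. In coordinates: for fixed \<open>s\<close> the substitution
  \<open>b = x $ 2 + s * t\<close> absorbs the factor \<open>s\<close>, and a translation handles
  the first coordinate. Only an inequality results because the cone is part of the plane.\<close>

lemma nn_integral_cone_le:
  fixes h :: "pt \<Rightarrow> ennreal"
  assumes [measurable]: "h \<in> borel_measurable borel" and "0 \<le> r"
  shows "(\<integral>\<^sup>+ t. (\<integral>\<^sup>+ s. ennreal s * h (x + s *\<^sub>R vector [1, t]) * indicator {r..R} s \<partial>lborel)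
           * indicator {0..1} t \<partial>lborel) \<le> (\<integral>\<^sup>+ x. h x \<partial>lborel)"
proof -
  have vec: "x + s *\<^sub>R vector [1, t] = vector [x $ 1 + s, x $ 2 + s * t]" for s t :: real
    by (simp add: vec_eq_iff forall_2)
  let ?H = "\<lambda>s t. ennreal s * h (vector [x $ 1 + s, x $ 2 + s * t]) * indicator {r..R} s * indicator {0..1} t"
  have "(\<integral>\<^sup>+ t. (\<integral>\<^sup>+ s. ennreal s * h (x + s *\<^sub>R vector [1, t]) * indicator {r..R} s \<partial>lborel)
           * indicator {0..1} t \<partial>lborel) = (\<integral>\<^sup>+ t. \<integral>\<^sup>+ s. ?H s t \<partial>lborel \<partial>lborel)"
    unfolding vec by (subst nn_integral_multc) auto
  also have "\<dots> = (\<integral>\<^sup>+ s. \<integral>\<^sup>+ t. ?H s t \<partial>lborel \<partial>lborel)"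
    by (rule lborel_pair.Fubini') measurable
  also have "\<dots> \<le> (\<integral>\<^sup>+ s. \<integral>\<^sup>+ b. h (vector [x $ 1 + s, b]) \<partial>lborel \<partial>lborel)"
  proof (rule nn_integral_mono)
    fix s
    show "(\<integral>\<^sup>+ t. ?H s t \<partial>lborel) \<le> (\<integral>\<^sup>+ b. h (vector [x $ 1 + s, b]) \<partial>lborel)"
    \<comment> \<open>The affine substitution needs \<open>s \<noteq> 0\<close>; at the apex the
      weight \<open>ennreal s\<close> is zero anyway.\<close>
    proof (cases "s > 0 \<and> s \<in> {r..R}")
      case True
      have "(\<integral>\<^sup>+ t. ?H s t \<partial>lborel) \<le> (\<integral>\<^sup>+ t. ennreal s * h (vector [x $ 1 + s, x $ 2 + s * t]) \<partial>lborel)"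
        by (intro nn_integral_mono) (auto simp: indicator_def)
      also have "\<dots> = (\<integral>\<^sup>+ b. h (vector [x $ 1 + s, b]) \<partial>lborel)"
        using True by (subst nn_integral_real_affine[where c = s and t = "x $ 2"])
          (auto simp: nn_integral_cmult)
      finally show ?thesis .
    next
      case False
      then have "?H s t = 0" for t using \<open>0 \<le> r\<close> by (cases "s = 0") (auto simp: indicator_def)
      then show ?thesis by (simp only: nn_integral_const) simp
    qed
  qed
  also have "\<dots> = (\<integral>\<^sup>+ a. \<integral>\<^sup>+ b. h (vector [a, b]) \<partial>lborel \<partial>lborel)"
    by (subst (2) nn_integral_real_affine[where c = 1 and t = "x $ 1"]) auto
  also have "\<dots> = (\<integral>\<^sup>+ x. h x \<partial>lborel)"
    by (rule nn_integral_lborel_vec2[symmetric]) simp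
  finally show ?thesis .
qed

section \<open>Growth along the rays of a cone\<close>

text \<open>The left endpoint is a null set and is dropped on purpose: since
  \<open>0 powr c = 0\<close>, a radial weight with negative exponent is zero at the apex instead of
  infinite, and a pointwise bound by it can fail there.\<close>

lemma nn_integral_FTC_abs_le:
  fixes f f' :: "real \<Rightarrow> real"
  assumes "a \<le> b" and f: "\<And>s. (f has_real_derivative f' s) (at s)" and f': "continuous_on UNIV f'"
  shows "ennreal (f a - f b) \<le> (\<integral>\<^sup>+ s. ennreal \<bar>f' s\<bar> * indicator {a<..b} s \<partial>lborel)"
proof -
  have I: "(f' has_integral (f b - f a)) {a..b}"
    using \<open>a \<le> b\<close> f by (intro fundamental_theorem_of_calculus)
      (auto simp: has_real_derivative_iff_has_vector_derivative[symmetric] intro: has_field_derivative_at_within)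
  have J: "(\<lambda>s. \<bar>f' s\<bar>) integrable_on {a..b}"
    by (intro integrable_continuous_interval continuous_intros continuous_on_subset[OF f']) auto
  have "\<bar>integral {a..b} f'\<bar> \<le> integral {a..b} (\<lambda>s. \<bar>f' s\<bar>)"
    using integral_norm_bound_integral[OF has_integral_integrable[OF I] J] by simp
  then have "f a - f b \<le> integral {a..b} (\<lambda>s. \<bar>f' s\<bar>)"
    using integral_unique[OF I] by simp
  then have "ennreal (f a - f b) \<le> ennreal (integral {a..b} (\<lambda>s. \<bar>f' s\<bar>))"
    by (rule ennreal_leI)
  also have "\<dots> = (\<integral>\<^sup>+ s. ennreal \<bar>f' s\<bar> * indicator {a..b} s \<partial>lborel)"
    by (subst nn_integral_has_integral_lebesgue'[OF _ integrable_integral[OF J]]) auto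
  also have "\<dots> = (\<integral>\<^sup>+ s. ennreal \<bar>f' s\<bar> * indicator {a<..b} s \<partial>lborel)"
    by (intro nn_integral_cong_AE eventually_mono[OF AE_lborel_singleton[of a]]) (auto simp: indicator_def)
  finally show ?thesis .
qed

text \<open>The common frame of both radial estimates. The slope of \<open>w\<close> along a ray is
  split into a radial weight \<open>k\<close>, integrable in \<open>s\<close> alone, and a density
  \<open>h\<close> with the factor \<open>s\<close>. Averaging over \<open>t\<close> turns
  \<open>s ds dt\<close> into area, so the second part is controlled by the integral of
  \<open>h\<close> over the plane.\<close>

lemma cone_estimate:
  fixes w h :: "pt \<Rightarrow> real" and W :: "pt \<Rightarrow> pt" and k :: "real \<Rightarrow> real"
  assumes w: "\<And>y. (w has_derivative (\<lambda>d. W y \<bullet> d)) (at y)" and W: "continuous_on UNIV W"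
    and h: "continuous_on UNIV h" "\<And>y. 0 \<le> h y" "(\<integral>\<^sup>+ y. ennreal (h y) \<partial>lborel) \<le> ennreal H" "0 \<le> H"
    and r: "0 \<le> r" "r \<le> R"
    and k [measurable]: "k \<in> borel_measurable borel"
    and K: "(k has_integral K) {r..R}" "\<And>s. s \<in> {r..R} \<Longrightarrow> 0 \<le> k s"
    and c: "0 \<le> c"
    and bound: "\<And>s t. s \<in> {r<..R} \<Longrightarrow> t \<in> {0..1} \<Longrightarrow>
      \<bar>W (x + s *\<^sub>R vector [1, t]) \<bullet> vector [1, t]\<bar> \<le> k s + c * (s * h (x + s *\<^sub>R vector [1, t]))"
  shows "integral {0..1} (\<lambda>t. w (x + r *\<^sub>R vector [1, t]) - w (x + R *\<^sub>R vector [1, t])) \<le> K + c * H"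
proof -
  let ?e = "\<lambda>t :: real. vector [1, t] :: pt"
  let ?F = "\<lambda>t. w (x + r *\<^sub>R ?e t) - w (x + R *\<^sub>R ?e t)"
  have [measurable]: "h \<in> borel_measurable borel"
    by (rule borel_measurable_continuous_onI[OF h(1)])
  have K0: "0 \<le> K" using K by (rule has_integral_nonneg)
  have cw: "continuous_on S w" for S
    using w has_derivative_continuous continuous_at_imp_continuous_on by blast
  have e_eq: "?e t = axis 1 1 + t *\<^sub>R axis 2 1" for t
    by (simp add: vec_eq_iff forall_2 axis_def)
  have ce: "continuous_on S (\<lambda>t. x + s *\<^sub>R ?e t)" for S s
    unfolding e_eq by (intro continuous_intros)
  have cF: "continuous_on {0..1} ?F"
    by (intro continuous_intros continuous_on_compose2[OF cw[of UNIV] ce]) auto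
  have ray: "ennreal (?F t) \<le> (\<integral>\<^sup>+ s. ennreal (k s) * indicator {r..R} s \<partial>lborel)
      + ennreal c * (\<integral>\<^sup>+ s. ennreal s * ennreal (h (x + s *\<^sub>R ?e t)) * indicator {r..R} s \<partial>lborel)"
    if t: "t \<in> {0..1}" for t
  proof -
    have "ennreal (?F t) \<le> (\<integral>\<^sup>+ s. ennreal \<bar>W (x + s *\<^sub>R ?e t) \<bullet> ?e t\<bar> * indicator {r<..R} s \<partial>lborel)"
    proof (rule nn_integral_FTC_abs_le[OF r(2)])
      fix s
      have "((\<lambda>s. x + s *\<^sub>R ?e t) has_derivative (\<lambda>d. d *\<^sub>R ?e t)) (at s)"
        by (auto intro!: derivative_eq_intros)
      from has_derivative_compose[OF this w]
      show "((\<lambda>s. w (x + s *\<^sub>R ?e t)) has_real_derivative W (x + s *\<^sub>R ?e t) \<bullet> ?e t) (at s)"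
        by (simp add: has_field_derivative_def mult.commute[of "_ \<bullet> _"] mult_commute_abs)
    next
      show "continuous_on UNIV (\<lambda>s. W (x + s *\<^sub>R ?e t) \<bullet> ?e t)"
        by (intro continuous_intros continuous_on_compose2[OF W]) auto
    qed
    also have "\<dots> \<le> (\<integral>\<^sup>+ s. ennreal (k s) * indicator {r..R} s
        + ennreal c * (ennreal s * ennreal (h (x + s *\<^sub>R ?e t)) * indicator {r..R} s) \<partial>lborel)"
    proof (rule nn_integral_mono)
      fix s
      show "ennreal \<bar>W (x + s *\<^sub>R ?e t) \<bullet> ?e t\<bar> * indicator {r<..R} s \<le> ennreal (k s) * indicator {r..R} s
        + ennreal c * (ennreal s * ennreal (h (x + s *\<^sub>R ?e t)) * indicator {r..R} s)"
      proof (cases "s \<in> {r<..R}")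
        case True
        then show ?thesis
          using bound[OF True t] c h(2) r K(2)[of s]
          by (auto simp: indicator_def ennreal_mult[symmetric] ennreal_plus[symmetric] simp del: ennreal_plus)
      qed auto
    qed
    also have "\<dots> = (\<integral>\<^sup>+ s. ennreal (k s) * indicator {r..R} s \<partial>lborel)
      + ennreal c * (\<integral>\<^sup>+ s. ennreal s * ennreal (h (x + s *\<^sub>R ?e t)) * indicator {r..R} s \<partial>lborel)"
      by (subst nn_integral_add) (auto simp: nn_integral_cmult)
    finally show ?thesis .
  qed
  have k_eq: "(\<integral>\<^sup>+ s. ennreal (k s) * indicator {r..R} s \<partial>lborel) = ennreal K"
    by (rule nn_integral_has_integral_lebesgue'[OF K(2,1)])
  \<comment> \<open>\<open>ennreal\<close> sends negative values to \<open>0\<close>, so the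
    positive part is what the nonnegative integral sees. Passing to it only enlarges the
    average.\<close>
  have cp: "continuous_on {0..1} (\<lambda>t. max (?F t) 0)"
    by (intro continuous_intros cF)
  have "ennreal (integral {0..1} (\<lambda>t. max (?F t) 0))
      = (\<integral>\<^sup>+ t. ennreal (max (?F t) 0) * indicator {0..1} t \<partial>lborel)"
    by (subst nn_integral_has_integral_lebesgue'[OF _ integrable_integral[OF integrable_continuous_interval[OF cp]]]) auto
  also have "\<dots> \<le> (\<integral>\<^sup>+ t. ennreal K * indicator {0..1} t + ennreal c *
      ((\<integral>\<^sup>+ s. ennreal s * ennreal (h (x + s *\<^sub>R ?e t)) * indicator {r..R} s \<partial>lborel) * indicator {0..1} t) \<partial>lborel)"
  proof (rule nn_integral_mono)
    fix t
    have "ennreal (max (?F t) 0) = ennreal (?F t)"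
      by (simp add: max_def ennreal_neg)
    then show "ennreal (max (?F t) 0) * indicator {0..1} t \<le> ennreal K * indicator {0..1} t + ennreal c *
      ((\<integral>\<^sup>+ s. ennreal s * ennreal (h (x + s *\<^sub>R ?e t)) * indicator {r..R} s \<partial>lborel) * indicator {0..1} t)"
      using ray[of t] unfolding k_eq by (cases "t \<in> {0..1}") simp_all
  qed
  also have "\<dots> = ennreal K + ennreal c *
      (\<integral>\<^sup>+ t. (\<integral>\<^sup>+ s. ennreal s * ennreal (h (x + s *\<^sub>R ?e t)) * indicator {r..R} s \<partial>lborel) * indicator {0..1} t \<partial>lborel)"
    by (subst nn_integral_add) (auto simp: nn_integral_cmult nn_integral_cmult_indicator)
  also have "\<dots> \<le> ennreal K + ennreal c * ennreal H"
    by (intro add_mono mult_left_mono order_trans[OF nn_integral_cone_le h(3)] order_refl r) auto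
  also have "\<dots> = ennreal (K + c * H)"
    using K0 c h(4) by (simp add: ennreal_mult[symmetric])
  finally have "integral {0..1} (\<lambda>t. max (?F t) 0) \<le> K + c * H"
    using K0 c h(4) by (subst (asm) ennreal_le_iff) auto
  moreover have "integral {0..1} ?F \<le> integral {0..1} (\<lambda>t. max (?F t) 0)"
    by (intro integral_le integrable_continuous_interval cF cp) auto
  ultimately show ?thesis by linarith
qed

text \<open>Young's inequality with cruder constants: above the threshold
  \<open>l powr (- 1 / (p - 1))\<close> one has \<open>l * a powr (p - 1) \<ge> 1\<close>.\<close>

lemma le_powr_add_powr:
  fixes a l p :: real
  assumes "0 < l" "0 \<le> a" "1 < p"
  shows "a \<le> l * a powr p + l powr (- 1 / (p - 1))"
proof (cases "a \<le> l powr (- 1 / (p - 1))")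
  case True
  then show ?thesis using assms by (simp add: add_increasing)
next
  case False
  then have a: "a > 0" using assms by (meson linorder_not_le order_le_less_trans powr_ge_zero)
  have "inverse l = (l powr (- 1 / (p - 1))) powr (p - 1)"
  proof -
    have "- 1 / (p - 1) * (p - 1) = - 1" using assms by simp
    then show ?thesis using assms by (simp only: powr_powr) (simp add: powr_minus)
  qed
  also have "\<dots> \<le> a powr (p - 1)"
    using False assms by (intro powr_mono2) auto
  finally have "1 \<le> l * a powr (p - 1)"
    using assms by (simp add: field_simps)
  then have "a * 1 \<le> a * (l * a powr (p - 1))" using a by (intro mult_left_mono) auto
  also have "\<dots> = l * a powr p"
    using a by (simp add: powr_diff)
  finally show ?thesis by (simp add: add_increasing2)
qed

lemma norm_cone_direction: "t \<in> {0..1} \<Longrightarrow> norm (vector [1, t] :: pt) \<le> 2"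
  using norm_le_l1_cart[of "vector [1, t] :: pt"] by (simp add: sum_2)

text \<open>An averaged Morrey estimate. Young's inequality with \<open>l = s powr (p / 2)\<close>
  leaves the weight \<open>s powr (- (p / 2) / (p - 1))\<close>, which is integrable at the apex
  because \<open>p > 2\<close>, while \<open>s powr (p / 2)\<close> contains the factor
  \<open>s\<close> of the area element with a positive power to spare. The exponent
  \<open>\<alpha>\<close> is below the Morrey exponent \<open>1 - 2 / p\<close>, but its positivity
  is all that matters later.\<close>

lemma cone_mean_oscillation:
  fixes v :: "pt \<Rightarrow> real" and p G r :: real
  assumes v: "smooth v" and p: "2 < p"
    and G: "(\<integral>\<^sup>+ y. ennreal (norm (cgrad v y) powr p) \<partial>lborel) \<le> ennreal G" "0 \<le> G"
    and r: "0 < r" "r \<le> 1"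
  defines "\<alpha> \<equiv> (p - 2) / (2 * (p - 1))"
  shows "integral {0..1} (\<lambda>t. v x - v (x + r *\<^sub>R vector [1, t])) \<le> (1 / \<alpha> + 2 powr p * G) * r powr \<alpha>"
proof -
  let ?k = "\<lambda>s :: real. s powr (- (p / 2) / (p - 1))"
  \<comment> \<open>After clearing denominators the last inequality is
    \<open>(p - 2)\<^sup>2 \<ge> 0\<close>. As \<open>r \<le> 1\<close>, it lets
    \<open>r powr \<alpha>\<close> dominate \<open>r powr (p / 2 - 1)\<close>.\<close>
  have \<alpha>: "\<alpha> > 0" "- (p / 2) / (p - 1) + 1 = \<alpha>" "\<alpha> \<le> p / 2 - 1"
    using p zero_le_power2[of "p - 2"] by (auto simp: \<alpha>_def field_simps power2_eq_square)
  have "integral {0..1} (\<lambda>t. v (x + 0 *\<^sub>R vector [1, t]) - v (x + r *\<^sub>R vector [1, t]))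
    \<le> r powr \<alpha> / \<alpha> + (2 powr p * r powr \<alpha>) * G"
  proof (rule cone_estimate[where k = ?k and h = "\<lambda>y. norm (cgrad v y) powr p"])
    show "(v has_derivative (\<lambda>d. cgrad v y \<bullet> d)) (at y)" for y
      by (rule smooth_has_derivative[OF v])
    show "continuous_on UNIV (cgrad v)"
      by (rule smooth_continuous_cgrad[OF v])
    show "continuous_on UNIV (\<lambda>y. norm (cgrad v y) powr p)"
      using p by (intro continuous_on_powr' continuous_intros smooth_continuous_cgrad[OF v]) auto
    show "(?k has_integral r powr \<alpha> / \<alpha>) {0..r}"
      using has_integral_powr_from_0[of "- (p / 2) / (p - 1)" r] \<alpha> r by simp
  next
    fix s t :: real assume s: "s \<in> {0<..r}" and t: "t \<in> {0..1}"
    let ?g = "cgrad v (x + s *\<^sub>R vector [1, t])"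
    let ?a = "\<bar>?g \<bullet> vector [1, t]\<bar>"
    have a: "?a \<le> 2 * norm ?g"
      using Cauchy_Schwarz_ineq2[of ?g "vector [1, t]"] mult_left_mono[OF norm_cone_direction[OF t], of "norm ?g"]
      by simp
    have "?a \<le> s powr (p / 2) * ?a powr p + (s powr (p / 2)) powr (- 1 / (p - 1))"
      using s p by (intro le_powr_add_powr) auto
    also have "(s powr (p / 2)) powr (- 1 / (p - 1)) = ?k s"
      by (simp add: powr_powr)
    also have "s powr (p / 2) * ?a powr p \<le> (s * r powr \<alpha>) * (2 powr p * norm ?g powr p)"
    proof (rule mult_mono)
      have "s powr (p / 2) = s * s powr (p / 2 - 1)"
        using s by (simp add: powr_diff)
      also have "s powr (p / 2 - 1) \<le> r powr (p / 2 - 1)"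
        using s p by (intro powr_mono2) auto
      also have "\<dots> \<le> r powr \<alpha>"
        using r \<alpha> by (intro powr_mono') auto
      finally show "s powr (p / 2) \<le> s * r powr \<alpha>" using s by simp
      have "?a powr p \<le> (2 * norm ?g) powr p"
        using a p by (intro powr_mono2) auto
      then show "?a powr p \<le> 2 powr p * norm ?g powr p" by (simp add: powr_mult)
    qed (use s in auto)
    finally show "?a \<le> ?k s + 2 powr p * r powr \<alpha> * (s * norm ?g powr p)"
      by (simp add: mult_ac)
  qed (use G r in auto)
  then show ?thesis by (simp add: algebra_simps)
qed

text \<open>The function \<open>w = - ln (M + e - v)\<close> equals \<open>- ln (M + e)\<close> at
  cone parameter \<open>R\<close> and is on average at least \<open>- ln (e + \<rho>)\<close> at
  parameter \<open>r\<close>. Such a rise is paid for by \<open>ln (R / r) / \<eta>\<close> from the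
  radial weight \<open>1 / (\<eta> * s)\<close> and by \<open>\<eta> * K\<close> from the Dirichlet
  energy of \<open>w\<close>; \<open>\<eta>\<close> balances the two.\<close>

lemma log_capacity_estimate:
  fixes v :: "pt \<Rightarrow> real" and M e K r R \<eta> \<rho> :: real
  assumes v: "smooth v" and M: "\<And>y. v y \<le> M" "v x = M" and e: "0 < e"
    and R: "\<And>t. t \<in> {0..1} \<Longrightarrow> v (x + R *\<^sub>R vector [1, t]) = 0"
    and K: "(\<integral>\<^sup>+ y. ennreal ((norm (cgrad v y) / (M + e - v y))\<^sup>2) \<partial>lborel) \<le> ennreal K" "0 \<le> K"
    and \<rho>: "integral {0..1} (\<lambda>t. v x - v (x + r *\<^sub>R vector [1, t])) \<le> \<rho>"
    and r: "0 < r" "r \<le> R" and \<eta>: "0 < \<eta>"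
  shows "ln (M + e) - ln (e + \<rho>) \<le> ln (R / r) / \<eta> + \<eta> * K"
proof -
  let ?E = "\<lambda>t :: real. vector [1, t] :: pt"
  define y where "y z = M + e - v z" for z
  have y: "y z \<ge> e" "y z > 0" for z using M(1)[of z] e by (auto simp: y_def)
  have ME: "M + e > 0" using R[of 0] M(1) e by (metis add_nonneg_pos atLeastAtMost_iff order_refl zero_le_one)
  have e_eq: "?E t = axis 1 1 + t *\<^sub>R axis 2 1" for t
    by (simp add: vec_eq_iff forall_2 axis_def)
  have cv: "continuous_on {0..1} (\<lambda>t. v (x + r *\<^sub>R ?E t))"
    unfolding e_eq by (intro continuous_on_compose2[OF smooth_continuous[OF v, of UNIV]] continuous_intros) auto
  have cy: "continuous_on UNIV y"
    unfolding y_def by (intro continuous_intros smooth_continuous v)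
  have "integral {0..1} (\<lambda>t. - ln (y (x + r *\<^sub>R ?E t)) - - ln (y (x + R *\<^sub>R ?E t)))
     \<le> (ln R - ln r) / \<eta> + \<eta> * K"
  proof (rule cone_estimate[where k = "\<lambda>s. 1 / (\<eta> * s)" and h = "\<lambda>z. (norm (cgrad v z) / y z)\<^sup>2"
        and W = "\<lambda>z. (1 / y z) *\<^sub>R cgrad v z" and w = "\<lambda>z. - ln (y z)"])
    fix z
    show "((\<lambda>z. - ln (y z)) has_derivative (\<lambda>d. ((1 / y z) *\<^sub>R cgrad v z) \<bullet> d)) (at z)"
      unfolding y_def using y(2)[of z]
      by (auto intro!: derivative_eq_intros smooth_has_derivative[OF v] simp: y_def divide_simps)
  next
    show "continuous_on UNIV (\<lambda>z. (1 / y z) *\<^sub>R cgrad v z)"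
      using y(2) by (intro continuous_intros cy smooth_continuous_cgrad[OF v]) (auto simp: less_imp_neq[symmetric])
    show "continuous_on UNIV (\<lambda>z. (norm (cgrad v z) / y z)\<^sup>2)"
      using y(2) by (intro continuous_intros cy smooth_continuous_cgrad[OF v]) (auto simp: less_imp_neq[symmetric])
    have "((\<lambda>s. 1 / (\<eta> * s)) has_integral (ln R / \<eta> - ln r / \<eta>)) {r..R}"
      using r \<eta> by (intro fundamental_theorem_of_calculus)
        (auto simp: has_real_derivative_iff_has_vector_derivative[symmetric] field_simps
          intro!: derivative_eq_intros)
    then show "((\<lambda>s. 1 / (\<eta> * s)) has_integral (ln R - ln r) / \<eta>) {r..R}"
      by (simp add: diff_divide_distrib)
    show "(\<integral>\<^sup>+ z. ennreal ((norm (cgrad v z) / y z)\<^sup>2) \<partial>lborel) \<le> ennreal K"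
      using K by (simp add: y_def)
  next
    fix s t :: real assume s: "s \<in> {r<..R}" and t: "t \<in> {0..1}"
    let ?z = "x + s *\<^sub>R ?E t"
    let ?a = "norm (cgrad v ?z) / y ?z"
    have "\<bar>((1 / y ?z) *\<^sub>R cgrad v ?z) \<bullet> ?E t\<bar> \<le> norm ((1 / y ?z) *\<^sub>R cgrad v ?z) * norm (?E t)"
      by (rule Cauchy_Schwarz_ineq2)
    also have "\<dots> \<le> ?a * 2"
      using y(2)[of ?z] norm_cone_direction[OF t] by (intro mult_mono) auto
    \<comment> \<open>Expand the square of \<open>1 - \<eta> * s * ?a\<close>. The weight is chosen
      so that \<open>?a\<^sup>2\<close> comes with exactly the factor \<open>s\<close> of the area
      element.\<close>
    also have "\<dots> \<le> 1 / (\<eta> * s) + \<eta> * (s * ?a\<^sup>2)"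
    proof -
      have "0 \<le> (1 - \<eta> * s * ?a)\<^sup>2 / (\<eta> * s)" using s r \<eta> by auto
      also have "\<dots> = 1 / (\<eta> * s) + \<eta> * (s * ?a\<^sup>2) - ?a * 2"
      proof -
        have "\<eta> * s \<noteq> 0" using s r \<eta> by auto
        then have "(1 - \<eta> * s * a)\<^sup>2 / (\<eta> * s) = 1 / (\<eta> * s) + \<eta> * (s * a\<^sup>2) - a * 2" for a
          by (simp add: field_simps power2_eq_square)
        then show ?thesis .
      qed
      finally show ?thesis by simp
    qed
    finally show "\<bar>((1 / y ?z) *\<^sub>R cgrad v ?z) \<bullet> ?E t\<bar> \<le> 1 / (\<eta> * s) + \<eta> * (s * ?a\<^sup>2)" .
  qed (use r \<eta> K in auto)
  also have "(ln R - ln r) / \<eta> = ln (R / r) / \<eta>"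
    using r by (simp add: ln_div)
  also have "integral {0..1} (\<lambda>t. - ln (y (x + r *\<^sub>R ?E t)) - - ln (y (x + R *\<^sub>R ?E t)))
    = integral {0..1} (\<lambda>t. ln (M + e) - ln (y (x + r *\<^sub>R ?E t)))"
    by (intro integral_cong) (simp add: R y_def)
  finally have upper: "integral {0..1} (\<lambda>t. ln (M + e) - ln (y (x + r *\<^sub>R ?E t)))
      \<le> ln (R / r) / \<eta> + \<eta> * K" .
  let ?D = "\<lambda>t. v x - v (x + r *\<^sub>R ?E t)"
  have D: "?D integrable_on {0..1}"
    by (intro integrable_continuous_interval continuous_intros cv)
  \<comment> \<open>The mean drop below the maximum is nonnegative, which forces
    \<open>\<rho> \<ge> 0\<close> and makes \<open>ln (e + \<rho>)\<close> meaningful.\<close>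
  have "0 \<le> integral {0..1} ?D"
    by (rule integral_nonneg[OF D]) (use M in auto)
  with \<rho> have a: "0 < e + \<rho>" using e by linarith
  \<comment> \<open>Jensen's inequality for \<open>- ln\<close> by way of the tangent line at \<open>e + \<rho>\<close>.\<close>
  have "ln (M + e) - ln (e + \<rho>) \<le> ln (M + e) - ln (e + \<rho>) + (\<rho> - integral {0..1} ?D) / (e + \<rho>)"
    using a \<rho> by simp
  also have "\<dots> = integral {0..1} (\<lambda>t. ln (M + e) - ln (e + \<rho>) + \<rho> / (e + \<rho>) - ?D t / (e + \<rho>))"
    using integral_unique[OF has_integral_diff[OF
        has_integral_const_real[of "ln (M + e) - ln (e + \<rho>) + \<rho> / (e + \<rho>)" 0 1]
        has_integral_divide[OF integrable_integral[OF D], of "e + \<rho>"]]]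
    by (simp add: diff_divide_distrib)
  also have "\<dots> \<le> integral {0..1} (\<lambda>t. ln (M + e) - ln (y (x + r *\<^sub>R ?E t)))"
  proof (rule integral_le)
    show "(\<lambda>t. ln (M + e) - ln (e + \<rho>) + \<rho> / (e + \<rho>) - ?D t / (e + \<rho>)) integrable_on {0..1}"
      using a by (intro integrable_continuous_interval continuous_intros cv) auto
    show "(\<lambda>t. ln (M + e) - ln (y (x + r *\<^sub>R ?E t))) integrable_on {0..1}"
    proof (intro integrable_continuous_interval continuous_intros)
      show "continuous_on {0..1} (\<lambda>t. y (x + r *\<^sub>R ?E t))"
        unfolding y_def by (intro continuous_intros cv)
      show "\<forall>t\<in>{0..1}. y (x + r *\<^sub>R ?E t) \<noteq> 0" using y(2) by (auto simp: less_imp_neq[symmetric])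
    qed
    fix t :: real
    let ?y = "y (x + r *\<^sub>R ?E t)"
    have "ln (?y / (e + \<rho>)) \<le> ?y / (e + \<rho>) - 1"
      using y(2) a by (intro ln_le_minus_one) auto
    moreover have "ln (?y / (e + \<rho>)) = ln ?y - ln (e + \<rho>)"
      using y(2)[of "x + r *\<^sub>R ?E t"] a by (simp add: ln_div)
    moreover have "?y / (e + \<rho>) - 1 = ?D t / (e + \<rho>) - \<rho> / (e + \<rho>)"
    proof -
      have "(d - \<rho> + c) / c - 1 = d / c - \<rho> / c" if "0 < c" for c d
        using that by (simp add: field_simps)
      from this[OF a, of "?D t"] show ?thesis using M(2) by (simp add: y_def algebra_simps)
    qed
    ultimately show "ln (M + e) - ln (e + \<rho>) + \<rho> / (e + \<rho>) - ?D t / (e + \<rho>) \<le> ln (M + e) - ln ?y"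
      by linarith
  qed
  finally show ?thesis using upper by linarith
qed

subsection \<open>Test functions\<close>

lemma compact_closed_subset: "compact K \<Longrightarrow> closed S \<Longrightarrow> S \<subseteq> K \<Longrightarrow> compact S"
  using compact_Int_closed[of K S] by (simp add: inf.absorb2)

lemma test_fun_smooth: "test_fun \<Omega> v \<Longrightarrow> smooth v"
  by (simp add: test_fun_def)

lemma test_fun_zero_outside: "test_fun \<Omega> v \<Longrightarrow> x \<notin> \<Omega> \<Longrightarrow> v x = 0"
  using closure_subset[of "{x. v x \<noteq> 0}"] by (auto simp: test_fun_def)

text \<open>The complement of the closure is open, so \<open>v\<close> vanishes in a whole
  neighbourhood of \<open>x\<close>.\<close>

lemma cgrad_zero_outside_support:
  assumes "x \<notin> closure {x. v x \<noteq> 0}" shows "cgrad v x = 0"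
proof (rule cgrad_eqI)
  have "((\<lambda>x. 0) has_derivative (\<lambda>h. 0 :: real)) (at x)" by simp
  then have "(v has_derivative (\<lambda>h. 0)) (at x)"
    by (rule has_derivative_transform_within_open[of _ _ _ _ "- closure {x. v x \<noteq> 0}"])
      (use assms closure_subset[of "{x. v x \<noteq> 0}"] in auto)
  then show "(v has_derivative (\<lambda>h. 0 \<bullet> h)) (at x)" by simp
qed

lemma test_fun_cgrad_zero_outside: "test_fun \<Omega> v \<Longrightarrow> x \<notin> \<Omega> \<Longrightarrow> cgrad v x = 0"
  by (rule cgrad_zero_outside_support) (auto simp: test_fun_def)

lemma test_fun_bounded:
  assumes "test_fun \<Omega> v"
  obtains B where "\<And>x. \<bar>v x\<bar> \<le> B" "\<And>x. norm (cgrad v x) \<le> B"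
proof -
  let ?S = "closure {x. v x \<noteq> 0}"
  have S: "compact ?S" and v: "smooth v" using assms by (auto simp: test_fun_def)
  have "bounded (v ` ?S)" "bounded (cgrad v ` ?S)"
    by (intro compact_imp_bounded compact_continuous_image S smooth_continuous[OF v] smooth_continuous_cgrad[OF v])+
  then obtain B C where B: "\<And>x. x \<in> ?S \<Longrightarrow> \<bar>v x\<bar> \<le> B" and C: "\<And>x. x \<in> ?S \<Longrightarrow> norm (cgrad v x) \<le> C"
    unfolding bounded_iff by fastforce
  have "\<bar>v x\<bar> \<le> max 0 (max B C)" for x
    using B[of x] subsetD[OF closure_subset, of x "{x. v x \<noteq> 0}"] by (cases "x \<in> ?S"; cases "v x = 0") auto
  moreover have "norm (cgrad v x) \<le> max 0 (max B C)" for x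
    using C[of x] cgrad_zero_outside_support[of x v] by (cases "x \<in> ?S") auto
  ultimately show ?thesis by (rule that)
qed

lemma test_fun_attains_max:
  assumes "test_fun \<Omega> v" "v z \<noteq> 0"
  obtains x where "x \<in> \<Omega>" "v x \<noteq> 0" "\<And>y. \<bar>v y\<bar> \<le> \<bar>v x\<bar>"
proof -
  let ?S = "closure {x. v x \<noteq> 0}"
  have S: "compact ?S" and v: "smooth v" using assms by (auto simp: test_fun_def)
  have zS: "z \<in> ?S" using assms(2) by (intro subsetD[OF closure_subset]) simp
  have "\<exists>x\<in>?S. \<forall>y\<in>?S. \<bar>v y\<bar> \<le> \<bar>v x\<bar>"
    by (rule continuous_attains_sup[OF S _ continuous_on_rabs[OF smooth_continuous[OF v]]])
      (metis zS empty_iff)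
  then obtain x where x: "x \<in> ?S" "\<And>y. y \<in> ?S \<Longrightarrow> \<bar>v y\<bar> \<le> \<bar>v x\<bar>"
    by auto
  have nz: "v x \<noteq> 0" using x(2)[OF zS] assms(2) by auto
  moreover have "\<bar>v y\<bar> \<le> \<bar>v x\<bar>" for y
    using x(2)[of y] subsetD[OF closure_subset, of y "{x. v x \<noteq> 0}"] by (cases "y \<in> ?S"; cases "v y = 0") auto
  moreover have "x \<in> \<Omega>" using nz test_fun_zero_outside[OF assms(1)] by blast
  ultimately show ?thesis using that by blast
qed

lemma test_fun_scale:
  assumes "test_fun \<Omega> v" shows "test_fun \<Omega> (\<lambda>x. c * v x)" "cgrad (\<lambda>x. c * v x) x = c *\<^sub>R cgrad v x"
proof -
  have sub: "closure {x. c * v x \<noteq> 0} \<subseteq> closure {x. v x \<noteq> 0}" by (intro closure_mono) auto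
  then have "compact (closure {x. c * v x \<noteq> 0})"
    using assms unfolding test_fun_def by (metis closed_closure compact_closed_subset)
  then show "test_fun \<Omega> (\<lambda>x. c * v x)"
    using assms sub unfolding test_fun_def by (auto intro!: smooth_mult smooth_const)
  show "cgrad (\<lambda>x. c * v x) x = c *\<^sub>R cgrad v x"
    by (rule cgrad_eqI) (auto intro!: derivative_eq_intros smooth_has_derivative test_fun_smooth[OF assms])
qed

text \<open>Subtracting \<open>inverse c\<close> makes \<open>f\<close> vanish wherever
  \<open>v\<close> does, so the support does not grow. The inner product of its gradient with
  \<open>cgrad v x\<close> is \<open>(norm (cgrad v x) / (c - v x))\<^sup>2\<close>, the energy
  density of \<open>- ln (c - v)\<close>.\<close>

lemma test_fun_reciprocal:
  fixes c :: real
  assumes v: "test_fun \<Omega> v" and c: "\<And>x. v x < c"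
  defines "f \<equiv> \<lambda>x. inverse (c - v x) - inverse c"
  shows "test_fun \<Omega> f" "cgrad f x = (1 / (c - v x)\<^sup>2) *\<^sub>R cgrad v x"
proof -
  have sm: "smooth v" using v by (rule test_fun_smooth)
  have "smooth (\<lambda>x. inverse (c + (- 1) * v x) + - inverse c)"
    using c by (intro smooth_add smooth_inverse smooth_mult smooth_const sm) (auto simp: less_imp_neq[symmetric])
  then have "smooth f" by (simp add: f_def)
  have sub: "closure {x. f x \<noteq> 0} \<subseteq> closure {x. v x \<noteq> 0}"
    by (intro closure_mono) (auto simp: f_def)
  then have "compact (closure {x. f x \<noteq> 0})"
    using v unfolding test_fun_def by (metis closed_closure compact_closed_subset)
  then show "test_fun \<Omega> f"
    using v sub \<open>smooth f\<close> unfolding test_fun_def by auto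
  show "cgrad f x = (1 / (c - v x)\<^sup>2) *\<^sub>R cgrad v x"
  proof (rule cgrad_eqI)
    show "(f has_derivative (\<lambda>h. ((1 / (c - v x)\<^sup>2) *\<^sub>R cgrad v x) \<bullet> h)) (at x)"
      unfolding f_def using c[of x]
      by (auto intro!: derivative_eq_intros smooth_has_derivative[OF sm]
          simp: power2_eq_square divide_inverse mult_ac fun_eq_iff)
  qed
qed

subsection \<open>The energy estimate\<close>

lemma norm_matrix_vector_le:
  fixes A :: "real^2^2"
  assumes "\<And>i j. \<bar>A $ i $ j\<bar> \<le> a"
  shows "norm (A *v d) \<le> 4 * a * norm d"
proof -
  have "norm (A *v d) \<le> (\<Sum>i\<in>UNIV. \<bar>(A *v d) $ i\<bar>)"
    by (rule norm_le_l1_cart)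
  also have "\<dots> \<le> (\<Sum>i\<in>(UNIV :: 2 set). \<Sum>j\<in>(UNIV :: 2 set). a * norm d)"
  proof (rule sum_mono)
    fix i :: 2
    have "\<bar>(A *v d) $ i\<bar> \<le> (\<Sum>j\<in>UNIV. \<bar>A $ i $ j * d $ j\<bar>)"
      unfolding matrix_vector_mult_def by (simp add: sum_abs)
    also have "\<dots> \<le> (\<Sum>j\<in>(UNIV :: 2 set). a * norm d)"
    proof (rule sum_mono)
      fix j :: 2
      show "\<bar>A $ i $ j * d $ j\<bar> \<le> a * norm d"
        unfolding abs_mult using assms[of i j] component_le_norm_cart[of d j] by (intro mult_mono) auto
    qed
    finally show "\<bar>(A *v d) $ i\<bar> \<le> (\<Sum>j\<in>(UNIV :: 2 set). a * norm d)" .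
  qed
  also have "\<dots> = 4 * a * norm d" by simp
  finally show ?thesis .
qed

lemma weighted_AM_GM:
  fixes a b c :: real
  assumes "0 < c" shows "a * b \<le> c * a\<^sup>2 + b\<^sup>2 / (4 * c)"
proof -
  have "0 \<le> (2 * c * a - b)\<^sup>2 / (4 * c)" using assms by simp
  also have "\<dots> = c * a\<^sup>2 + b\<^sup>2 / (4 * c) - a * b"
    using assms by (simp add: field_simps power2_eq_square)
  finally show ?thesis by simp
qed

text \<open>Here \<open>D\<close> is the gradient of the approximant \<open>v\<close>,
  \<open>g\<close> that of \<open>u\<close>, \<open>y\<close> the shifted distance
  \<open>M + e - v\<close> to the maximum and \<open>f\<close> the test function. Exchanging
  \<open>g\<close> for \<open>D\<close> makes ellipticity applicable; the two mixed terms are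
  absorbed by \<open>\<delta> / 4\<close> each, which leaves \<open>\<delta> / 2\<close>. The
  coefficient of \<open>(norm b)\<^sup>2\<close> is free of \<open>e\<close>, whereas the errors in
  \<open>D - g\<close> and \<open>v - u\<close> may carry powers of \<open>1 / e\<close>, since they
  are made small after \<open>e\<close> is fixed.\<close>

lemma energy_pointwise:
  fixes A :: "real^2^2" and D g b :: pt and v u y f e \<delta> lam :: real
  assumes \<delta>: "0 < \<delta>"
    and ell: "\<delta> * (norm D)\<^sup>2 \<le> (\<Sum>i\<in>UNIV. \<Sum>j\<in>UNIV. A $ i $ j * D $ i * D $ j)"
    and A: "\<And>i j. \<bar>A $ i $ j\<bar> \<le> 1 / \<delta>"
    and e: "0 < e" "e \<le> y" and f: "\<bar>f\<bar> \<le> 1 / y" "0 \<le> v * f" and lam: "0 \<le> lam"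
  shows "\<delta> / 2 * (norm D / y)\<^sup>2 \<le> (A *v g) \<bullet> ((1 / y\<^sup>2) *\<^sub>R D) + (b \<bullet> g + lam * u) * f
    + ((1 / \<delta> + 1) * (norm b)\<^sup>2 + (16 / \<delta> ^ 3 + 1) / e\<^sup>2 * (norm (D - g))\<^sup>2 + lam / e * \<bar>v - u\<bar>)"
proof -
  let ?d = "D - g" and ?q = "norm D / y"
  have y: "0 < y" using e by simp
  have fe: "\<bar>f\<bar> \<le> 1 / e" using f(1) e by (meson divide_left_mono mult_pos_pos order_trans y zero_le_one)
  have AD: "\<delta> * (norm D)\<^sup>2 \<le> (A *v D) \<bullet> D"
    using ell by (simp add: inner_vec_def matrix_vector_mult_def sum_2 algebra_simps)
  have 1: "\<delta> * ?q\<^sup>2 \<le> (A *v D) \<bullet> ((1 / y\<^sup>2) *\<^sub>R D)"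
    using divide_right_mono[OF AD, of "y\<^sup>2"] by (simp add: power_divide)
  \<comment> \<open>Split \<open>1 / y\<^sup>2\<close> evenly between the two factors, so that
    \<open>D\<close> appears as \<open>?q\<close>.\<close>
  have 2: "(A *v ?d) \<bullet> ((1 / y\<^sup>2) *\<^sub>R D) \<le> \<delta> / 4 * ?q\<^sup>2 + 16 / \<delta> ^ 3 / e\<^sup>2 * (norm ?d)\<^sup>2"
  proof -
    have "(A *v ?d) \<bullet> ((1 / y\<^sup>2) *\<^sub>R D) \<le> norm (A *v ?d) * norm ((1 / y\<^sup>2) *\<^sub>R D)"
      by (rule norm_cauchy_schwarz)
    also have "\<dots> \<le> (4 * (1 / \<delta>) * norm ?d) * norm ((1 / y\<^sup>2) *\<^sub>R D)"
      by (intro mult_right_mono norm_matrix_vector_le A) auto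
    also have "\<dots> = ?q * (4 / \<delta> * (norm ?d / y))"
      using y by (simp add: power2_eq_square mult_ac)
    also have "\<dots> \<le> \<delta> / 4 * ?q\<^sup>2 + (4 / \<delta> * (norm ?d / y))\<^sup>2 / (4 * (\<delta> / 4))"
      using \<delta> by (intro weighted_AM_GM) simp
    also have "(4 / \<delta> * (norm ?d / y))\<^sup>2 / (4 * (\<delta> / 4)) = 16 / \<delta> ^ 3 * (norm ?d / y)\<^sup>2"
      using \<delta> by (simp add: field_simps power2_eq_square power3_eq_cube)
    also have "\<dots> \<le> 16 / \<delta> ^ 3 * (norm ?d / e)\<^sup>2"
      using \<delta> e by (intro mult_left_mono power_mono divide_left_mono) auto
    finally show ?thesis by (simp add: power_divide)
  qed
  \<comment> \<open>Using \<open>\<bar>f\<bar> \<le> 1 / y\<close> instead of \<open>1 / e\<close>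
    pairs the weight with \<open>D\<close>, so no power of \<open>1 / e\<close> falls on
    \<open>b\<close>.\<close>
  have 3: "- (b \<bullet> D * f) \<le> \<delta> / 4 * ?q\<^sup>2 + 1 / \<delta> * (norm b)\<^sup>2"
  proof -
    have "- (b \<bullet> D * f) \<le> \<bar>b \<bullet> D\<bar> * \<bar>f\<bar>" by (metis abs_ge_minus_self abs_mult)
    also have "\<dots> \<le> (norm b * norm D) * (1 / y)"
      by (intro mult_mono Cauchy_Schwarz_ineq2 f) auto
    also have "\<dots> = ?q * norm b" by simp
    also have "\<dots> \<le> \<delta> / 4 * ?q\<^sup>2 + (norm b)\<^sup>2 / (4 * (\<delta> / 4))"
      using \<delta> by (intro weighted_AM_GM) simp
    finally show ?thesis by simp
  qed
  have 4: "b \<bullet> ?d * f \<le> (norm b)\<^sup>2 + 1 / e\<^sup>2 * (norm ?d)\<^sup>2"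
  proof -
    have "b \<bullet> ?d * f \<le> \<bar>b \<bullet> ?d\<bar> * \<bar>f\<bar>" by (metis abs_ge_self abs_mult)
    also have "\<dots> \<le> (norm b * norm ?d) * (1 / e)"
      by (intro mult_mono Cauchy_Schwarz_ineq2 fe) auto
    also have "\<dots> = norm b * (norm ?d / e)" by simp
    also have "\<dots> \<le> 1 * (norm b)\<^sup>2 + (norm ?d / e)\<^sup>2 / (4 * 1)"
      by (rule weighted_AM_GM) simp
    also have "\<dots> \<le> (norm b)\<^sup>2 + (norm ?d / e)\<^sup>2" by simp
    finally show ?thesis by (simp add: power_divide)
  qed
  \<comment> \<open>The zero order term has a good sign for \<open>v\<close>, because
    \<open>v * f \<ge> 0\<close> and \<open>lam \<ge> 0\<close>; only the difference
    \<open>v - u\<close> has to be estimated.\<close>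
  have 5: "- (lam * u * f) \<le> lam / e * \<bar>v - u\<bar>"
  proof -
    have "- (lam * u * f) = lam * ((v - u) * f) - lam * (v * f)" by (simp add: algebra_simps)
    also have "\<dots> \<le> lam * ((v - u) * f)" using lam f by simp
    also have "\<dots> \<le> lam * (\<bar>v - u\<bar> * \<bar>f\<bar>)"
      using lam by (intro mult_left_mono) (auto simp flip: abs_mult)
    also have "\<dots> \<le> lam * (\<bar>v - u\<bar> * (1 / e))"
      using lam fe by (intro mult_left_mono) auto
    finally show ?thesis by simp
  qed
  have "(A *v g) \<bullet> ((1 / y\<^sup>2) *\<^sub>R D) = (A *v D) \<bullet> ((1 / y\<^sup>2) *\<^sub>R D) - (A *v ?d) \<bullet> ((1 / y\<^sup>2) *\<^sub>R D)"
    by (simp add: matrix_vector_mult_diff_distrib inner_diff_left diff_divide_distrib)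
  moreover have "(b \<bullet> g + lam * u) * f = b \<bullet> D * f - b \<bullet> ?d * f + lam * u * f"
    by (simp add: inner_diff_right algebra_simps)
  moreover have "(1 / \<delta> + 1) * (norm b)\<^sup>2 = 1 / \<delta> * (norm b)\<^sup>2 + (norm b)\<^sup>2"
    "(16 / \<delta> ^ 3 + 1) / e\<^sup>2 * (norm ?d)\<^sup>2 = 16 / \<delta> ^ 3 / e\<^sup>2 * (norm ?d)\<^sup>2 + 1 / e\<^sup>2 * (norm ?d)\<^sup>2"
    "\<delta> / 2 * ?q\<^sup>2 = \<delta> * ?q\<^sup>2 - \<delta> / 4 * ?q\<^sup>2 - \<delta> / 4 * ?q\<^sup>2"
    by (simp_all add: algebra_simps add_divide_distrib)
  ultimately show ?thesis using 1 2 3 4 5 by linarith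
qed

section \<open>Integrals of lower powers on finite measure spaces\<close>

lemma powr_le_interpolate:
  fixes a s q p :: real
  assumes "0 \<le> a" "0 < s" "0 < q" "q < p"
  shows "a powr q \<le> s powr q + s powr (q - p) * a powr p"
proof (cases "a \<le> s")
  case True
  then have "a powr q \<le> s powr q" using assms by (intro powr_mono2) auto
  then show ?thesis by (simp add: add_increasing2)
next
  case False
  then have "a powr (q - p) \<le> s powr (q - p)" using assms by (intro powr_mono2') auto
  then have "a powr (q - p) * a powr p \<le> s powr (q - p) * a powr p" by (intro mult_right_mono) auto
  moreover have "a powr (q - p) * a powr p = a powr q" using False assms by (simp flip: powr_add)
  ultimately show ?thesis by (simp add: add_increasing)
qed

context finite_measure
begin

text \<open>Splitting values at the level \<open>s\<close> takes the place of Hoelder's inequality: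
  small values contribute at most \<open>s powr q\<close> times the total measure, large ones are
  controlled by the power \<open>p\<close>. The level stays free so that the first term can be made
  small.\<close>

lemma integrable_powr_interpolate:
  fixes f :: "'a \<Rightarrow> 'b::euclidean_space" and q p :: real
  assumes [measurable]: "f \<in> borel_measurable M" and f: "integrable M (\<lambda>x. norm (f x) powr p)"
    and "0 < q" "q < p" "0 < s"
  shows "integrable M (\<lambda>x. norm (f x) powr q)"
    and "(\<integral>x. norm (f x) powr q \<partial>M) \<le> s powr q * measure M (space M) + s powr (q - p) * (\<integral>x. norm (f x) powr p \<partial>M)"
proof -
  have le: "norm (f x) powr q \<le> t powr q + t powr (q - p) * norm (f x) powr p" if "0 < t" for x t
    using assms that by (intro powr_le_interpolate) auto
  show I: "integrable M (\<lambda>x. norm (f x) powr q)"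
    by (rule Bochner_Integration.integrable_bound[of M "\<lambda>x. 1 powr q + 1 powr (q - p) * norm (f x) powr p"])
      (use f le[of 1] in auto)
  have "(\<integral>x. norm (f x) powr q \<partial>M) \<le> (\<integral>x. s powr q + s powr (q - p) * norm (f x) powr p \<partial>M)"
    using f le \<open>0 < s\<close> by (intro integral_mono I) auto
  also have "\<dots> = s powr q * measure M (space M) + s powr (q - p) * (\<integral>x. norm (f x) powr p \<partial>M)"
    using f by (subst Bochner_Integration.integral_add) (auto simp: mult.commute)
  finally show "(\<integral>x. norm (f x) powr q \<partial>M) \<le> s powr q * measure M (space M) + s powr (q - p) * (\<integral>x. norm (f x) powr p \<partial>M)" .
qed

lemma integral_powr_tendsto_0:
  fixes f :: "nat \<Rightarrow> 'a \<Rightarrow> 'b::euclidean_space" and q p :: real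
  assumes "\<And>n. f n \<in> borel_measurable M" and "\<And>n. integrable M (\<lambda>x. norm (f n x) powr p)"
    and lim: "(\<lambda>n. \<integral>x. norm (f n x) powr p \<partial>M) \<longlonglongrightarrow> 0" and q: "0 < q" "q < p"
  shows "(\<lambda>n. \<integral>x. norm (f n x) powr q \<partial>M) \<longlonglongrightarrow> 0"
proof (rule tendstoI)
  fix e :: real assume "0 < e"
  let ?m = "measure M (space M)"
  \<comment> \<open>Chosen to make \<open>s powr q * ?m\<close> at most \<open>e / 2\<close>; adding
    \<open>1\<close> guards against measure zero.\<close>
  define s where "s = (e / (2 * (?m + 1))) powr (1 / q)"
  have m: "?m + 1 > 0" by (simp add: add_nonneg_pos)
  have s: "0 < s" "s powr q = e / (2 * (?m + 1))"
    using \<open>0 < e\<close> q m by (auto simp: s_def powr_powr zero_less_divide_iff)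
  have "(\<lambda>n. s powr (q - p) * (\<integral>x. norm (f n x) powr p \<partial>M)) \<longlonglongrightarrow> s powr (q - p) * 0"
    by (intro tendsto_intros lim)
  then have "\<forall>\<^sub>F n in sequentially. s powr (q - p) * (\<integral>x. norm (f n x) powr p \<partial>M) < e / 2"
    using \<open>0 < e\<close> by (intro order_tendstoD(2)[where y = 0]) auto
  then show "\<forall>\<^sub>F n in sequentially. dist (\<integral>x. norm (f n x) powr q \<partial>M) 0 < e"
  proof eventually_elim
    case (elim n)
    have "s powr q * ?m \<le> e / 2"
      using \<open>0 < e\<close> m unfolding s(2) by (simp add: field_simps)
    moreover have "0 \<le> (\<integral>x. norm (f n x) powr q \<partial>M)" by simp
    ultimately show ?case
      using elim integrable_powr_interpolate(2)[OF assms(1,2) q s(1), of n] by (simp add: dist_real_def)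
  qed
qed

end

text \<open>Connects the cone estimates, stated for \<open>lborel\<close> on the whole plane, with
  the weak equation, stated on \<open>\<Omega>\<close>.\<close>

lemma nn_integral_lborel_eq_lebesgue_on:
  fixes h :: "pt \<Rightarrow> real"
  assumes "\<Omega> \<in> sets lebesgue" "integrable (lebesgue_on \<Omega>) h" "\<And>x. 0 \<le> h x" "\<And>x. x \<notin> \<Omega> \<Longrightarrow> h x = 0"
  shows "(\<integral>\<^sup>+ x. ennreal (h x) \<partial>lborel) = ennreal (\<integral>x. h x \<partial>lebesgue_on \<Omega>)"
proof -
  have "(\<integral>\<^sup>+ x. ennreal (h x) \<partial>lborel) = (\<integral>\<^sup>+ x. ennreal (h x) \<partial>lebesgue)"
    by (simp add: nn_integral_completion)
  also have "\<dots> = (\<integral>\<^sup>+ x. ennreal (h x) * indicator \<Omega> x \<partial>lebesgue)"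
    using assms(4) by (intro nn_integral_cong) (auto simp: indicator_def)
  also have "\<dots> = (\<integral>\<^sup>+ x. ennreal (h x) \<partial>lebesgue_on \<Omega>)"
    using assms(1) by (subst nn_integral_restrict_space) auto
  also have "\<dots> = ennreal (\<integral>x. h x \<partial>lebesgue_on \<Omega>)"
    using assms by (intro nn_integral_eq_integral) auto
  finally show ?thesis .
qed

section \<open>Integrating the energy inequality\<close>

lemma borel_measurable_matrix_form:
  fixes A :: "'a \<Rightarrow> real^2^2" and g D :: "'a \<Rightarrow> pt"
  assumes "A \<in> borel_measurable M" "g \<in> borel_measurable M" "D \<in> borel_measurable M"
  shows "(\<lambda>x. (A x *v g x) \<bullet> D x) \<in> borel_measurable M"
proof -
  have nth: "(\<lambda>x. h x $ i) \<in> borel_measurable M" if "h \<in> borel_measurable M" for h :: "'a \<Rightarrow> pt" and i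
    by (rule measurable_compose[OF that borel_measurable_continuous_onI]) (intro continuous_intros)
  have "(\<lambda>x. A x $ i) \<in> borel_measurable M" for i
    by (rule measurable_compose[OF assms(1) borel_measurable_continuous_onI]) (intro continuous_intros)
  note [measurable] = nth[OF this] nth[OF assms(2)] nth[OF assms(3)]
  show ?thesis
    by (simp add: inner_vec_def matrix_vector_mult_def sum_2)
qed

text \<open>Test the equation with the reciprocal function of \<open>v\<close> and integrate the
  pointwise inequality; the part coming from the equation integrates to zero.\<close>

lemma energy_estimate:
  fixes A :: "pt \<Rightarrow> real^2^2" and b g :: "pt \<Rightarrow> pt" and u v :: "pt \<Rightarrow> real"
  assumes \<Omega>: "open \<Omega>" "bounded \<Omega>" and A: "A \<in> borel_measurable lebesgue" and \<delta>: "0 < \<delta>" "elliptic \<delta> A"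
    and b: "b \<in> borel_measurable (lebesgue_on \<Omega>)" "integrable (lebesgue_on \<Omega>) (\<lambda>x. (norm (b x))\<^sup>2)"
    and g: "g \<in> borel_measurable (lebesgue_on \<Omega>)" "integrable (lebesgue_on \<Omega>) (\<lambda>x. (norm (g x))\<^sup>2)"
    and u: "integrable (lebesgue_on \<Omega>) u" and lam: "0 \<le> lam"
    and weak: "\<And>\<phi>. test_fun \<Omega> \<phi> \<Longrightarrow> integral\<^sup>L (lebesgue_on \<Omega>)
        (\<lambda>x. (A x *v g x) \<bullet> cgrad \<phi> x + (b x \<bullet> g x + lam * u x) * \<phi> x) = 0"
    and v: "test_fun \<Omega> v" "\<And>x. \<bar>v x\<bar> \<le> m" and e: "0 < e"
  shows "(\<integral>\<^sup>+ x. ennreal ((norm (cgrad v x) / (m + e - v x))\<^sup>2) \<partial>lborel) \<le>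
     ennreal (2 / \<delta> * ((1 / \<delta> + 1) * (\<integral>x. (norm (b x))\<^sup>2 \<partial>lebesgue_on \<Omega>)
       + (16 / \<delta> ^ 3 + 1) / e\<^sup>2 * (\<integral>x. (norm (cgrad v x - g x))\<^sup>2 \<partial>lebesgue_on \<Omega>)
       + lam / e * (\<integral>x. \<bar>v x - u x\<bar> \<partial>lebesgue_on \<Omega>)))"
proof -
  let ?M = "lebesgue_on \<Omega>"
  define y where "y x = m + e - v x" for x
  define f where "f x = inverse (m + e - v x) - inverse (m + e)" for x
  have S: "\<Omega> \<in> sets lebesgue" using \<Omega> by auto
  interpret finite_measure ?M
    using \<Omega> by (intro finite_measure_lebesgue_on lmeasurable_open)
  obtain B where B: "\<And>x. \<bar>v x\<bar> \<le> B" "\<And>x. norm (cgrad v x) \<le> B"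
    using test_fun_bounded[OF v(1)] by blast
  have B0: "0 \<le> B" using B(1)[of 0] by linarith
  have sv: "smooth v" by (rule test_fun_smooth[OF v(1)])
  have y: "e \<le> y x" "0 < y x" for x using v(2)[of x] e by (auto simp: y_def)
  have m: "0 < m + e" using v(2)[of 0] e by linarith
  have vless: "v x < m + e" for x using y(2)[of x] by (simp add: y_def)
  note test = test_fun_reciprocal[OF v(1) vless, folded f_def, folded y_def]
  \<comment> \<open>This form shows that \<open>f\<close> has the sign of \<open>v\<close> and, as
    \<open>\<bar>v x\<bar> \<le> m\<close>, is dominated by \<open>1 / y\<close>.\<close>
  have f_eq: "f x = v x / (m + e) * (1 / y x)" for x
    using y(2)[of x] m by (simp add: f_def y_def field_simps)
  have vm: "\<bar>v x / (m + e)\<bar> \<le> 1" for x using v(2)[of x] e m by (simp add: abs_divide)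
  have f: "\<bar>f x\<bar> \<le> 1 / y x" "0 \<le> v x * f x" for x
  proof -
    show "\<bar>f x\<bar> \<le> 1 / y x"
      unfolding f_eq abs_mult using mult_right_mono[OF vm, of "\<bar>1 / y x\<bar>"] y(2)[of x] by simp
    have "v x * f x = (v x)\<^sup>2 / ((m + e) * y x)" by (simp add: f_eq power2_eq_square)
    then show "0 \<le> v x * f x" using m y(2)[of x] by simp
  qed
  have fe: "\<bar>f x\<bar> \<le> 1 / e" for x
    using f(1)[of x] y[of x] e by (meson divide_left_mono mult_pos_pos order_trans zero_le_one)
  have mc: "h \<in> borel_measurable ?M" if "continuous_on \<Omega> h" for h :: "pt \<Rightarrow> 'b::euclidean_space"
    by (rule continuous_imp_measurable_on_sets_lebesgue[OF that S])
  have [measurable]: "b \<in> borel_measurable ?M" "g \<in> borel_measurable ?M" "u \<in> borel_measurable ?M"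
    "v \<in> borel_measurable ?M" "cgrad v \<in> borel_measurable ?M" "y \<in> borel_measurable ?M" "f \<in> borel_measurable ?M"
    using b g u mc[OF smooth_continuous[OF sv]] mc[OF smooth_continuous_cgrad[OF sv]]
      mc[OF smooth_continuous[OF test_fun_smooth[OF test(1)]]]
    by (auto simp: y_def[abs_def])
  have [measurable]: "A \<in> borel_measurable ?M" using A by (rule measurable_restrict_space1)
  let ?D = "\<lambda>x. (1 / (y x)\<^sup>2) *\<^sub>R cgrad v x"
  have [measurable]: "(\<lambda>x. (A x *v g x) \<bullet> ?D x) \<in> borel_measurable ?M"
    by (intro borel_measurable_matrix_form) measurable
  let ?I = "\<lambda>x. (A x *v g x) \<bullet> ?D x + (b x \<bullet> g x + lam * u x) * f x"
  have A_le: "\<bar>A x $ i $ j\<bar> \<le> 1 / \<delta>" for x i j using \<delta> by (auto simp: elliptic_def)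
  have le_sq: "s \<le> 1 + s\<^sup>2" for s :: real
    using zero_le_power2[of "s - 1"] zero_le_power2[of s]
    unfolding power2_diff one_power2 mult_1_right by linarith
  have prod_le: "s * t \<le> s\<^sup>2 + t\<^sup>2" for s t :: real
    using zero_le_power2[of "s - t"] zero_le_power2[of s] zero_le_power2[of t]
    unfolding power2_diff by linarith
  \<comment> \<open>Non-integrable functions have integral \<open>0\<close> by convention, so the
    weak equation alone would not permit splitting the integral of \<open>?I + ?E\<close>.\<close>
  have I: "integrable ?M ?I"
  proof (rule Bochner_Integration.integrable_bound)
    show "integrable ?M (\<lambda>x. (4 * (1 / \<delta>) * (1 + (norm (g x))\<^sup>2)) * (1 / e\<^sup>2 * B)
        + ((norm (b x))\<^sup>2 + (norm (g x))\<^sup>2 + lam * \<bar>u x\<bar>) * (1 / e))"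
      using b g u by auto
    have "norm (?I x) \<le> norm ((4 * (1 / \<delta>) * (1 + (norm (g x))\<^sup>2)) * (1 / e\<^sup>2 * B)
        + ((norm (b x))\<^sup>2 + (norm (g x))\<^sup>2 + lam * \<bar>u x\<bar>) * (1 / e))" for x
    proof -
      have "\<bar>(A x *v g x) \<bullet> ?D x\<bar> \<le> norm (A x *v g x) * norm (?D x)"
        by (rule Cauchy_Schwarz_ineq2)
      also have "\<dots> \<le> (4 * (1 / \<delta>) * (1 + (norm (g x))\<^sup>2)) * (1 / e\<^sup>2 * B)"
      proof (rule mult_mono)
        show "norm (A x *v g x) \<le> 4 * (1 / \<delta>) * (1 + (norm (g x))\<^sup>2)"
          using \<delta>(1) le_sq[of "norm (g x)"]
          by (intro order_trans[OF norm_matrix_vector_le[OF A_le]] mult_left_mono) auto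
        have "norm (?D x) = 1 / (y x)\<^sup>2 * norm (cgrad v x)" by simp
        also have "\<dots> \<le> 1 / e\<^sup>2 * B"
          using y[of x] e B(2)[of x] by (intro mult_mono divide_left_mono power_mono) auto
        finally show "norm (?D x) \<le> 1 / e\<^sup>2 * B" .
      qed (use \<delta>(1) in auto)
      finally have 1: "\<bar>(A x *v g x) \<bullet> ?D x\<bar> \<le> (4 * (1 / \<delta>) * (1 + (norm (g x))\<^sup>2)) * (1 / e\<^sup>2 * B)" .
      have "\<bar>b x \<bullet> g x + lam * u x\<bar> \<le> \<bar>b x \<bullet> g x\<bar> + lam * \<bar>u x\<bar>"
        using abs_triangle_ineq[of "b x \<bullet> g x" "lam * u x"] lam by (simp add: abs_mult)
      also have "\<bar>b x \<bullet> g x\<bar> \<le> (norm (b x))\<^sup>2 + (norm (g x))\<^sup>2"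
        using Cauchy_Schwarz_ineq2[of "b x" "g x"] prod_le[of "norm (b x)" "norm (g x)"] by linarith
      finally have "\<bar>b x \<bullet> g x + lam * u x\<bar> * \<bar>f x\<bar> \<le> ((norm (b x))\<^sup>2 + (norm (g x))\<^sup>2 + lam * \<bar>u x\<bar>) * (1 / e)"
        using fe[of x] lam by (intro mult_mono) auto
      then have 2: "\<bar>(b x \<bullet> g x + lam * u x) * f x\<bar> \<le> ((norm (b x))\<^sup>2 + (norm (g x))\<^sup>2 + lam * \<bar>u x\<bar>) * (1 / e)"
        by (simp add: abs_mult)
      show ?thesis using 1 2 unfolding real_norm_def by linarith
    qed
    then show "AE x in ?M. norm (?I x) \<le> norm ((4 * (1 / \<delta>) * (1 + (norm (g x))\<^sup>2)) * (1 / e\<^sup>2 * B)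
        + ((norm (b x))\<^sup>2 + (norm (g x))\<^sup>2 + lam * \<bar>u x\<bar>) * (1 / e))" by blast
  qed measurable
  have I0: "integral\<^sup>L ?M ?I = 0" using weak[OF test(1)] unfolding test(2) .
  have q: "integrable ?M (\<lambda>x. (norm (cgrad v x) / y x)\<^sup>2)"
  proof (rule integrable_const_bound[where B = "(B / e)\<^sup>2"])
    show "AE x in ?M. norm ((norm (cgrad v x) / y x)\<^sup>2) \<le> (B / e)\<^sup>2"
    proof (rule AE_I2)
      fix x
      have "norm (cgrad v x) / y x \<le> B / e" using y[of x] B(2)[of x] e B0 by (intro frac_le) auto
      then show "norm ((norm (cgrad v x) / y x)\<^sup>2) \<le> (B / e)\<^sup>2"
        using y(2)[of x] by (simp add: power_mono del: power_divide)
    qed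
  qed measurable
  have d: "integrable ?M (\<lambda>x. (norm (cgrad v x - g x))\<^sup>2)"
  proof (rule Bochner_Integration.integrable_bound[of _ "\<lambda>x. 2 * (B\<^sup>2 + (norm (g x))\<^sup>2)"])
    show "AE x in ?M. norm ((norm (cgrad v x - g x))\<^sup>2) \<le> norm (2 * (B\<^sup>2 + (norm (g x))\<^sup>2))"
    proof (rule AE_I2)
      fix x
      have "norm (cgrad v x - g x) \<le> B + norm (g x)"
        using norm_triangle_ineq4[of "cgrad v x" "g x"] B(2)[of x] by linarith
      then have "(norm (cgrad v x - g x))\<^sup>2 \<le> (B + norm (g x))\<^sup>2" by (intro power_mono) auto
      also have "\<dots> \<le> 2 * (B\<^sup>2 + (norm (g x))\<^sup>2)"
        using zero_le_power2[of "B - norm (g x)"] by (simp add: power2_eq_square algebra_simps)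
      finally show "norm ((norm (cgrad v x - g x))\<^sup>2) \<le> norm (2 * (B\<^sup>2 + (norm (g x))\<^sup>2))" by simp
    qed
  qed (use g in auto)
  have vi: "integrable ?M v" by (rule integrable_const_bound[where B = B]) (use B in auto)
  let ?E = "\<lambda>x. (1 / \<delta> + 1) * (norm (b x))\<^sup>2 + (16 / \<delta> ^ 3 + 1) / e\<^sup>2 * (norm (cgrad v x - g x))\<^sup>2
      + lam / e * \<bar>v x - u x\<bar>"
  have E: "integrable ?M ?E" using b d vi u by auto
  have "\<delta> / 2 * (\<integral>x. (norm (cgrad v x) / y x)\<^sup>2 \<partial>?M) = (\<integral>x. \<delta> / 2 * (norm (cgrad v x) / y x)\<^sup>2 \<partial>?M)"
    by (rule integral_mult_right_zero[symmetric])
  also have "\<dots> \<le> (\<integral>x. ?I x + ?E x \<partial>?M)"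
  proof (rule integral_mono)
    fix x
    show "\<delta> / 2 * (norm (cgrad v x) / y x)\<^sup>2 \<le> ?I x + ?E x"
      using \<delta> e y(1) f lam by (intro energy_pointwise) (auto simp: elliptic_def)
  qed (use q I E in auto)
  also have "\<dots> = (\<integral>x. ?E x \<partial>?M)"
    using Bochner_Integration.integral_add[OF I E] I0 by simp
  also have "\<dots> = (1 / \<delta> + 1) * (\<integral>x. (norm (b x))\<^sup>2 \<partial>?M)
       + (16 / \<delta> ^ 3 + 1) / e\<^sup>2 * (\<integral>x. (norm (cgrad v x - g x))\<^sup>2 \<partial>?M)
       + lam / e * (\<integral>x. \<bar>v x - u x\<bar> \<partial>?M)" (is "_ = ?T")
  proof -
    have 1: "integrable ?M (\<lambda>x. (1 / \<delta> + 1) * (norm (b x))\<^sup>2)" using b by auto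
    have 2: "integrable ?M (\<lambda>x. (16 / \<delta> ^ 3 + 1) / e\<^sup>2 * (norm (cgrad v x - g x))\<^sup>2)"
      by (rule integrable_mult_right[OF d])
    have 3: "integrable ?M (\<lambda>x. lam / e * \<bar>v x - u x\<bar>)" using vi u by auto
    show ?thesis
      by (simp only: Bochner_Integration.integral_add[OF Bochner_Integration.integrable_add[OF 1 2] 3]
          Bochner_Integration.integral_add[OF 1 2] integral_mult_right_zero)
  qed
  finally have "(\<integral>x. (norm (cgrad v x) / y x)\<^sup>2 \<partial>?M) \<le> 2 / \<delta> * ?T"
    using \<delta>(1) by (simp add: field_simps)
  moreover have "(\<integral>\<^sup>+ x. ennreal ((norm (cgrad v x) / y x)\<^sup>2) \<partial>lborel)
      = ennreal (\<integral>x. (norm (cgrad v x) / y x)\<^sup>2 \<partial>?M)"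
    by (rule nn_integral_lborel_eq_lebesgue_on[OF S q]) (auto simp: test_fun_cgrad_zero_outside[OF v(1)])
  ultimately show ?thesis unfolding y_def by (simp add: ennreal_leI)
qed

section \<open>Handling p-th powers of norms\<close>

lemma norm_add_powr_le:
  fixes a b :: "'a::real_normed_vector"
  assumes "0 < p" shows "norm (a + b) powr p \<le> 2 powr p * (norm a powr p + norm b powr p)"
proof -
  have "norm (a + b) \<le> 2 * max (norm a) (norm b)"
    using norm_triangle_ineq[of a b] by linarith
  then have "norm (a + b) powr p \<le> (2 * max (norm a) (norm b)) powr p"
    using assms by (intro powr_mono2) auto
  also have "\<dots> = 2 powr p * max (norm a) (norm b) powr p"
    by (simp add: powr_mult)
  also have "\<dots> \<le> 2 powr p * (norm a powr p + norm b powr p)"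
    by (intro mult_left_mono) (auto simp: max_def)
  finally show ?thesis .
qed

lemma Lp_norm_tendsto_0D:
  fixes f :: "nat \<Rightarrow> pt \<Rightarrow> 'b::euclidean_space"
  assumes "(\<lambda>n. Lp_norm p \<Omega> (f n)) \<longlonglongrightarrow> 0" "0 < p"
  shows "(\<lambda>n. \<integral>x. norm (f n x) powr p \<partial>lebesgue_on \<Omega>) \<longlonglongrightarrow> 0"
proof -
  have "(\<lambda>n. Lp_norm p \<Omega> (f n) powr p) \<longlonglongrightarrow> 0"
    using assms by (intro tendsto_zero_powrI[where b = p]) (auto simp: Lp_norm_def)
  moreover have "Lp_norm p \<Omega> (f n) powr p = (\<integral>x. norm (f n x) powr p \<partial>lebesgue_on \<Omega>)" for n
    using assms(2) by (simp add: Lp_norm_def powr_powr)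
  ultimately show ?thesis by simp
qed

subsection \<open>Vanishing of weak solutions\<close>

lemma eventually_mult_less:
  fixes X :: "nat \<Rightarrow> real"
  assumes "X \<longlonglongrightarrow> 0" "0 < d" shows "\<forall>\<^sub>F n in sequentially. c * X n < d"
  using order_tendstoD(2)[OF tendsto_mult[OF tendsto_const[of c] assms(1)]] assms(2) by simp

lemma weak_solution_zero:
  fixes A :: "pt \<Rightarrow> real^2^2" and b g :: "pt \<Rightarrow> pt" and u :: "pt \<Rightarrow> real" and p \<delta> lam :: real
  assumes p: "2 < p" and \<delta>: "0 < \<delta>" "elliptic \<delta> A" and \<Omega>: "open \<Omega>" "bounded \<Omega>"
    and A: "A \<in> borel_measurable lebesgue" and b: "Lp 2 \<Omega> b" and lam: "0 \<le> lam" and u: "W01p p \<Omega> u g"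
    and weak: "\<And>\<phi>. test_fun \<Omega> \<phi> \<Longrightarrow> integral\<^sup>L (lebesgue_on \<Omega>)
        (\<lambda>x. (A x *v g x) \<bullet> cgrad \<phi> x + (b x \<bullet> g x + lam * u x) * \<phi> x) = 0"
  shows "AE x in lebesgue_on \<Omega>. u x = 0"
proof (rule ccontr)
  assume nz: "\<not> (AE x in lebesgue_on \<Omega>. u x = 0)"
  let ?M = "lebesgue_on \<Omega>"
  have S: "\<Omega> \<in> sets lebesgue" using \<Omega> by auto
  interpret finite_measure ?M
    using \<Omega> by (intro finite_measure_lebesgue_on lmeasurable_open)
  from u obtain \<phi> where \<phi>: "\<And>n. test_fun \<Omega> (\<phi> n)"
    and lim_u: "(\<lambda>n. Lp_norm p \<Omega> (\<lambda>x. \<phi> n x - u x)) \<longlonglongrightarrow> 0"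
    and lim_g: "(\<lambda>n. Lp_norm p \<Omega> (\<lambda>x. cgrad (\<phi> n) x - g x)) \<longlonglongrightarrow> 0"
    and um: "u \<in> borel_measurable ?M" and up: "integrable ?M (\<lambda>x. norm (u x) powr p)"
    and gm: "g \<in> borel_measurable ?M" and gp: "integrable ?M (\<lambda>x. norm (g x) powr p)"
    unfolding W01p_def Lp_def by blast
  have bm: "b \<in> borel_measurable ?M" and b2: "integrable ?M (\<lambda>x. (norm (b x))\<^sup>2)"
    using b by (auto simp: Lp_def)
  have g2: "integrable ?M (\<lambda>x. (norm (g x))\<^sup>2)"
    using integrable_powr_interpolate(1)[OF gm gp, of 2 1] p by simp
  have u1: "integrable ?M u"
    using integrable_powr_interpolate(1)[OF um up, of 1 1] p um by (simp add: integrable_abs_iff)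
  have mc: "h \<in> borel_measurable ?M" if "continuous_on \<Omega> h" for h :: "pt \<Rightarrow> 'b::euclidean_space"
    by (rule continuous_imp_measurable_on_sets_lebesgue[OF that S])
  have \<phi>m: "\<phi> n \<in> borel_measurable ?M" "cgrad (\<phi> n) \<in> borel_measurable ?M" for n
    using mc[OF smooth_continuous] mc[OF smooth_continuous_cgrad] test_fun_smooth[OF \<phi>] by auto
  note [measurable] = um gm bm \<phi>m
  have \<phi>p: "integrable ?M (\<lambda>x. norm (\<phi> n x) powr p)" "integrable ?M (\<lambda>x. norm (cgrad (\<phi> n) x) powr p)" for n
  proof -
    obtain B where B: "\<And>x. \<bar>\<phi> n x\<bar> \<le> B" "\<And>x. norm (cgrad (\<phi> n) x) \<le> B"
      using test_fun_bounded[OF \<phi>] by blast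
    show "integrable ?M (\<lambda>x. norm (\<phi> n x) powr p)" "integrable ?M (\<lambda>x. norm (cgrad (\<phi> n) x) powr p)"
      using B p by (auto intro!: integrable_const_bound[where B = "B powr p"] AE_I2 powr_mono2)
  qed
  have diff_le: "norm (a - c) powr p \<le> 2 powr p * (norm a powr p + norm c powr p)" for a c :: "'b::real_normed_vector"
    using norm_add_powr_le[of p a "- c"] p by simp
  have diff_int: "integrable ?M (\<lambda>x. norm (h x - k x) powr p)"
    if [measurable]: "h \<in> borel_measurable ?M" "k \<in> borel_measurable ?M"
      and "integrable ?M (\<lambda>x. norm (h x) powr p)" "integrable ?M (\<lambda>x. norm (k x) powr p)"
    for h k :: "pt \<Rightarrow> 'b::euclidean_space"
    by (rule Bochner_Integration.integrable_bound[of ?M "\<lambda>x. 2 powr p * (norm (h x) powr p + norm (k x) powr p)"])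
      (use that diff_le in \<open>auto intro!: AE_I2\<close>)
  note eu = diff_int[OF \<phi>m(1) um \<phi>p(1) up] and eg = diff_int[OF \<phi>m(2) gm \<phi>p(2) gp]
  have limp_u: "(\<lambda>n. \<integral>x. norm (\<phi> n x - u x) powr p \<partial>?M) \<longlonglongrightarrow> 0"
    using Lp_norm_tendsto_0D[OF lim_u] p by simp
  have limp_g: "(\<lambda>n. \<integral>x. norm (cgrad (\<phi> n) x - g x) powr p \<partial>?M) \<longlonglongrightarrow> 0"
    using Lp_norm_tendsto_0D[OF lim_g] p by simp
  have lim1_u: "(\<lambda>n. \<integral>x. \<bar>\<phi> n x - u x\<bar> \<partial>?M) \<longlonglongrightarrow> 0"
    using integral_powr_tendsto_0[OF _ eu limp_u, of 1] p by simp
  have lim2_g: "(\<lambda>n. \<integral>x. (norm (cgrad (\<phi> n) x - g x))\<^sup>2 \<partial>?M) \<longlonglongrightarrow> 0"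
    using integral_powr_tendsto_0[OF _ eg limp_g, of 2] p by simp

  define U where "U = (\<integral>x. norm (u x) powr p \<partial>?M)"
  have "U \<noteq> 0"
    unfolding U_def using nz p by (subst integral_nonneg_eq_0_iff_AE[OF up]) auto
  moreover have "0 \<le> U" unfolding U_def by simp
  ultimately have U: "0 < U" by simp
  let ?\<mu> = "measure ?M (space ?M)"
  \<comment> \<open>If \<open>\<bar>\<phi> n\<bar> \<le> m\<close> held everywhere,
    \<open>\<phi> n\<close> would account for at most \<open>U / 4\<close> in the bound for
    \<open>U\<close>. Hence \<open>m\<close> is a lower bound for the maximum of good approximants
    that does not depend on \<open>n\<close> or \<open>e\<close>.\<close>
  define m where "m = (U / (4 * 2 powr p * (?\<mu> + 1))) powr (1 / p)"
  have \<mu>: "0 < ?\<mu> + 1" by (simp add: add_nonneg_pos)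
  have m: "0 < m" "m powr p = U / (4 * 2 powr p * (?\<mu> + 1))"
    using U p \<mu> by (auto simp: m_def powr_powr)
  define G where "G = 2 powr p * (1 + (\<integral>x. norm (g x) powr p \<partial>?M))"
  have G0: "0 \<le> G" unfolding G_def by simp
  define \<alpha> where "\<alpha> = (p - 2) / (2 * (p - 1))"
  have \<alpha>: "0 < \<alpha>" using p by (simp add: \<alpha>_def)
  define C where "C = 1 / \<alpha> + 2 powr p * G"
  have C: "0 < C" using \<alpha> G0 by (auto simp: C_def intro!: add_pos_nonneg)
  \<comment> \<open>The summand \<open>1\<close> is reserved for the two approximation errors, each
    below \<open>1 / 2\<close> once \<open>n\<close> is large. So \<open>K\<close> is fixed before
    \<open>e\<close>.\<close>
  define K where "K = 2 / \<delta> * ((1 / \<delta> + 1) * (\<integral>x. (norm (b x))\<^sup>2 \<partial>?M) + 1)"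
  have K0: "0 \<le> K" using \<delta>(1) by (auto simp: K_def)
  obtain R0 where R0: "0 < R0" "\<And>x. x \<in> \<Omega> \<Longrightarrow> norm x \<le> R0"
    using \<Omega>(2) bounded_pos by blast
  \<comment> \<open>Larger than the diameter of \<open>\<Omega>\<close>: from any apex in
    \<open>\<Omega>\<close>, the cone has left \<open>\<Omega>\<close> at parameter
    \<open>R\<close>.\<close>
  define R where "R = 2 * R0 + 1"
  have R: "1 \<le> R" using R0 by (simp add: R_def)
  \<comment> \<open>\<open>X\<close> collects the terms of the final inequality that are free of
    \<open>e\<close>. That inequality will read \<open>- ln e / 2 \<le> X\<close>, and
    \<open>e\<close> is chosen to contradict it.\<close>
  define X where "X = ln (1 + C) - ln m + \<alpha> / 2 * ln R + 2 * K / \<alpha>"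
  define e where "e = exp (- (2 * \<bar>X\<bar> + 1))"
  have e: "0 < e" "e \<le> 1" "ln e = - (2 * \<bar>X\<bar> + 1)" by (auto simp: e_def)
  \<comment> \<open>At this scale the mean drop of the approximant below its maximum is at most
    \<open>C * e\<close>, comparable to the shift \<open>e\<close>.\<close>
  define r where "r = e powr (1 / \<alpha>)"
  have r: "0 < r" "r \<le> 1" "r powr \<alpha> = e" "ln r = ln e / \<alpha>"
    using e \<alpha> by (auto simp: r_def powr_powr ln_powr intro!: powr_le1)

  \<comment> \<open>Only now is \<open>n\<close> chosen, since the errors to be made small carry
    factors \<open>1 / e\<close> and \<open>1 / e\<^sup>2\<close>.\<close>
  have "\<forall>\<^sub>F n in sequentially. 1 * (\<integral>x. norm (cgrad (\<phi> n) x - g x) powr p \<partial>?M) < 1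
    \<and> 2 powr p * (\<integral>x. norm (\<phi> n x - u x) powr p \<partial>?M) < U / 4
    \<and> (16 / \<delta> ^ 3 + 1) / e\<^sup>2 * (\<integral>x. (norm (cgrad (\<phi> n) x - g x))\<^sup>2 \<partial>?M) < 1 / 2
    \<and> lam / e * (\<integral>x. \<bar>\<phi> n x - u x\<bar> \<partial>?M) < 1 / 2"
    using U by (intro eventually_conj eventually_mult_less limp_u limp_g lim1_u lim2_g) auto
  then obtain n where n1: "(\<integral>x. norm (cgrad (\<phi> n) x - g x) powr p \<partial>?M) < 1"
    and n2: "2 powr p * (\<integral>x. norm (\<phi> n x - u x) powr p \<partial>?M) < U / 4"
    and n3: "(16 / \<delta> ^ 3 + 1) / e\<^sup>2 * (\<integral>x. (norm (cgrad (\<phi> n) x - g x))\<^sup>2 \<partial>?M) < 1 / 2"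
    and n4: "lam / e * (\<integral>x. \<bar>\<phi> n x - u x\<bar> \<partial>?M) < 1 / 2"
    by (auto simp: eventually_sequentially)

  have "\<exists>z. m < \<bar>\<phi> n z\<bar>"
  proof (rule ccontr)
    assume "\<not> ?thesis"
    then have le: "\<bar>\<phi> n z\<bar> \<le> m" for z by (simp add: not_less)
    have "U \<le> (\<integral>x. 2 powr p * (m powr p + norm (\<phi> n x - u x) powr p) \<partial>?M)"
      unfolding U_def
    proof (rule integral_mono[OF up])
      show "integrable ?M (\<lambda>x. 2 powr p * (m powr p + norm (\<phi> n x - u x) powr p))"
        using eu by auto
      fix x
      have "norm (u x) powr p \<le> 2 powr p * (norm (\<phi> n x) powr p + norm (\<phi> n x - u x) powr p)"
        using diff_le[of "\<phi> n x" "\<phi> n x - u x"] by simp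
      also have "\<dots> \<le> 2 powr p * (m powr p + norm (\<phi> n x - u x) powr p)"
        using le[of x] p by (intro mult_left_mono add_right_mono powr_mono2) auto
      finally show "norm (u x) powr p \<le> 2 powr p * (m powr p + norm (\<phi> n x - u x) powr p)" .
    qed
    also have "\<dots> = 2 powr p * m powr p * ?\<mu> + 2 powr p * (\<integral>x. norm (\<phi> n x - u x) powr p \<partial>?M)"
      using eu[of n] by (simp add: algebra_simps)
    also have "2 powr p * m powr p * ?\<mu> \<le> U / 4"
    proof -
      have "2 powr p * m powr p * ?\<mu> = U / 4 * (?\<mu> / (?\<mu> + 1))" unfolding m(2) by simp
      also have "\<dots> \<le> U / 4 * 1" using U \<mu> by (intro mult_left_mono) auto
      finally show ?thesis by simp
    qed
    finally show False using n2 U by linarith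
  qed
  then obtain z where z: "m < \<bar>\<phi> n z\<bar>" by blast
  then have "\<phi> n z \<noteq> 0" using m(1) by auto
  then obtain x where x: "x \<in> \<Omega>" "\<phi> n x \<noteq> 0" "\<And>y. \<bar>\<phi> n y\<bar> \<le> \<bar>\<phi> n x\<bar>"
    using test_fun_attains_max[OF \<phi>] by metis
  define M where "M = \<bar>\<phi> n x\<bar>"
  have mM: "m < M" using z x(3)[of z] by (simp add: M_def)
  \<comment> \<open>The sign turns the point of largest modulus into a maximum of \<open>v\<close>.
    By linearity the multiples of \<open>u\<close> and \<open>g\<close> by \<open>s\<close> satisfy
    the same equation.\<close>
  define s where "s = sgn (\<phi> n x)"
  have s: "\<bar>s\<bar> = 1" using x(2) by (simp add: s_def abs_sgn_eq)
  define v where "v y = s * \<phi> n y" for y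
  have v: "test_fun \<Omega> v" "cgrad v y = s *\<^sub>R cgrad (\<phi> n) y" "\<bar>v y\<bar> = \<bar>\<phi> n y\<bar>" for y
    unfolding v_def[abs_def] using test_fun_scale[OF \<phi>[of n], of s] s by (auto simp: abs_mult)
  have vM: "\<bar>v y\<bar> \<le> M" "v x = M" for y
    using x(3)[of y] v(3)[of y] by (auto simp: M_def v_def s_def sgn_if)

  have "(\<integral>\<^sup>+ y. ennreal ((norm (cgrad v y) / (M + e - v y))\<^sup>2) \<partial>lborel)
    \<le> ennreal (2 / \<delta> * ((1 / \<delta> + 1) * (\<integral>x. (norm (b x))\<^sup>2 \<partial>?M)
       + (16 / \<delta> ^ 3 + 1) / e\<^sup>2 * (\<integral>x. (norm (cgrad v x - s *\<^sub>R g x))\<^sup>2 \<partial>?M)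
       + lam / e * (\<integral>x. \<bar>v x - s * u x\<bar> \<partial>?M)))"
  proof (rule energy_estimate[OF \<Omega> A \<delta> bm b2 _ _ _ lam _ v(1) vM(1) e(1)])
    show "(\<lambda>x. s *\<^sub>R g x) \<in> borel_measurable ?M" by measurable
    show "integrable ?M (\<lambda>x. (norm (s *\<^sub>R g x))\<^sup>2)" using g2 s by simp
    show "integrable ?M (\<lambda>x. s * u x)" using u1 by simp
    fix f assume f: "test_fun \<Omega> f"
    have "(A x *v s *\<^sub>R g x) \<bullet> cgrad f x + (b x \<bullet> s *\<^sub>R g x + lam * (s * u x)) * f x
      = s * ((A x *v g x) \<bullet> cgrad f x + (b x \<bullet> g x + lam * u x) * f x)" for x
      by (simp add: matrix_vector_mult_scaleR algebra_simps)
    then show "integral\<^sup>L ?M (\<lambda>x. (A x *v s *\<^sub>R g x) \<bullet> cgrad f x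
        + (b x \<bullet> s *\<^sub>R g x + lam * (s * u x)) * f x) = 0"
      using weak[OF f] by simp
  qed
  also have "\<dots> \<le> ennreal K"
  proof (rule ennreal_leI)
    have 1: "norm (cgrad v x - s *\<^sub>R g x) = norm (cgrad (\<phi> n) x - g x)" for x
      using s by (simp add: v(2) scaleR_diff_right[symmetric])
    have 2: "\<bar>v x - s * u x\<bar> = \<bar>\<phi> n x - u x\<bar>" for x
      using s by (simp add: v_def right_diff_distrib[symmetric] abs_mult)
    show "2 / \<delta> * ((1 / \<delta> + 1) * (\<integral>x. (norm (b x))\<^sup>2 \<partial>?M)
       + (16 / \<delta> ^ 3 + 1) / e\<^sup>2 * (\<integral>x. (norm (cgrad v x - s *\<^sub>R g x))\<^sup>2 \<partial>?M)
       + lam / e * (\<integral>x. \<bar>v x - s * u x\<bar> \<partial>?M)) \<le> K"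
      unfolding K_def 1 2
    proof (rule mult_left_mono)
      show "0 \<le> 2 / \<delta>" using \<delta>(1) by simp
    qed (use n3 n4 in linarith)
  qed
  finally have energy: "(\<integral>\<^sup>+ y. ennreal ((norm (cgrad v y) / (M + e - v y))\<^sup>2) \<partial>lborel) \<le> ennreal K" .

  have gp_v: "integrable ?M (\<lambda>y. norm (cgrad v y) powr p)"
    using \<phi>p(2)[of n] s by (simp add: v(2))
  have "(\<integral>y. norm (cgrad v y) powr p \<partial>?M)
     \<le> (\<integral>y. 2 powr p * (norm (cgrad (\<phi> n) y - g y) powr p + norm (g y) powr p) \<partial>?M)"
  proof (rule integral_mono[OF gp_v])
    show "integrable ?M (\<lambda>y. 2 powr p * (norm (cgrad (\<phi> n) y - g y) powr p + norm (g y) powr p))"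
      using eg gp by auto
    show "norm (cgrad v y) powr p \<le> 2 powr p * (norm (cgrad (\<phi> n) y - g y) powr p + norm (g y) powr p)" for y
      using norm_add_powr_le[of p "cgrad (\<phi> n) y - g y" "g y"] p s by (simp add: v(2))
  qed
  also have "\<dots> = 2 powr p * ((\<integral>y. norm (cgrad (\<phi> n) y - g y) powr p \<partial>?M) + (\<integral>y. norm (g y) powr p \<partial>?M))"
    using eg[of n] gp by simp
  also have "\<dots> \<le> G" unfolding G_def using n1 by (intro mult_left_mono) auto
  finally have "(\<integral>\<^sup>+ y. ennreal (norm (cgrad v y) powr p) \<partial>lborel) \<le> ennreal G"
    by (subst nn_integral_lborel_eq_lebesgue_on[OF S gp_v])
      (auto simp: test_fun_cgrad_zero_outside[OF v(1)] intro: ennreal_leI)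
  from cone_mean_oscillation[OF test_fun_smooth[OF v(1)] p this G0 r(1,2), of x, folded \<alpha>_def, unfolded r(3), folded C_def]
  have osc: "integral {0..1} (\<lambda>t. v x - v (x + r *\<^sub>R vector [1, t])) \<le> C * e" .
  have outside: "v (x + R *\<^sub>R vector [1, t]) = 0" for t
  proof -
    have "1 \<le> norm (vector [1, t] :: pt)"
      using component_le_norm_cart[of "vector [1, t] :: pt" 1] by simp
    then have "R \<le> norm (R *\<^sub>R (vector [1, t] :: pt))" using R by simp
    moreover have "norm (R *\<^sub>R (vector [1, t] :: pt)) \<le> norm (x + R *\<^sub>R vector [1, t]) + norm x"
      using norm_triangle_ineq4[of "x + R *\<^sub>R vector [1, t]" x] by simp
    ultimately have "R0 < norm (x + R *\<^sub>R vector [1, t])"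
      using R0(2)[OF x(1)] R0(1) unfolding R_def by linarith
    then show ?thesis using R0(2) test_fun_zero_outside[OF v(1)] by (meson not_less)
  qed
  \<comment> \<open>With \<open>\<eta> = 2 / \<alpha>\<close> and
    \<open>ln r = ln e / \<alpha>\<close> the radial weight costs only \<open>- ln e / 2\<close>,
    against a gain of \<open>- ln e\<close> on the left.\<close>
  have "ln (M + e) - ln (e + C * e) \<le> ln (R / r) / (2 / \<alpha>) + 2 / \<alpha> * K"
    by (rule log_capacity_estimate[OF test_fun_smooth[OF v(1)] _ vM(2) e(1) outside energy K0 osc r(1)])
      (use vM(1) r R \<alpha> in \<open>auto intro: order_trans[OF abs_ge_self]\<close>)
  moreover have "ln m \<le> ln (M + e)" using m mM e by simp
  moreover have "ln (e + C * e) = ln e + ln (1 + C)"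
  proof -
    have "e + C * e = e * (1 + C)" by (simp add: algebra_simps)
    then show ?thesis using e C by (simp add: ln_mult)
  qed
  moreover have "ln (R / r) / (2 / \<alpha>) = \<alpha> / 2 * ln R - ln e / 2"
    using r R \<alpha> by (simp add: ln_div field_simps)
  moreover have "2 / \<alpha> * K = 2 * K / \<alpha>" by simp
  ultimately have "- ln e / 2 \<le> X" unfolding X_def by linarith
  then show False using e(3) by linarith
qed

theorem theorem4p1:
  fixes p \<delta> :: real
  assumes "2 < p" and "0 < \<delta>" and "\<delta> < 1"
  shows "\<exists>\<Gamma> :: real \<Rightarrow> real \<Rightarrow> real. (\<forall>s t. 0 < \<Gamma> s t) \<and>
    (\<forall>(\<Omega> :: pt set) (A :: pt \<Rightarrow> real^2^2) (c :: pt \<Rightarrow> pt) (b :: pt \<Rightarrow> pt) (lam :: real)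
       (u :: pt \<Rightarrow> real) (g :: pt \<Rightarrow> pt).
       open \<Omega> \<and> connected \<Omega> \<and> bounded \<Omega> \<and>
       A \<in> borel_measurable lebesgue \<and> elliptic \<delta> A \<and>
       weak_div \<Omega> A c \<and> Lp 2 \<Omega> b \<and> 0 \<le> lam \<and>
       assumption_A (\<Gamma> (Lp_norm 2 \<Omega> c) (Lp_norm 2 \<Omega> b)) A \<and>
       W01p p \<Omega> u g \<and>
       (\<forall>\<phi>. test_fun \<Omega> \<phi> \<longrightarrow>
          integral\<^sup>L (lebesgue_on \<Omega>)
            (\<lambda>x. (A x *v g x) \<bullet> cgrad \<phi> x + (b x \<bullet> g x + lam * u x) * \<phi> x) = 0)
     \<longrightarrow> (AE x in lebesgue_on \<Omega>. u x = 0))"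
  using weak_solution_zero[OF assms(1,2)]
  by (intro exI[of _ "\<lambda>s t. 1"] conjI allI impI) auto

end
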